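(* Let $\Gamma$ be a reduct of $\mathbb{P}$ such that $\bot$ and $<$ are primitive positive definable in $\Gamma$. Then ${\rm Low}$ is not primitive positive definable in $\Gamma$ if and only if ${\rm Pol}(\Gamma)$ contains one of the functions $e_<$ or $e_\leq$.
   Context: $\mathbb{P}=(P;\leq)$ is the random partial order (Fraïssé limit of all finite partial orders); a reduct of $\mathbb{P}$ is a structure on $P$ whose relations are first-order definable in $\mathbb{P}$. $x<y$ means $x\leq y\wedge x\neq y$; $x\bot y$ means $x,y$ incomparable; $z\bot xy$ abbreviates $z\bot x\wedge z\bot y$. ${\rm Low}(x,y,z):=(x<y\wedge z\bot xy)\vee(x<z\wedge y\bot xz)$. Primitive positive definable: definable by $\exists\bar y$ (conjunction of atomic formulas). ${\rm Pol}(\Gamma)$ is the set of finitary operations on $P$ preserving all relations of $\Gamma$ componentwise. $e_<:P^2\to P$ is a fixed embedding of $(P;<)^2$ into $(P;<)$, i.e. injective with $e_<(a,b)<e_<(a',b')\iff(a<a'\wedge b<b')$; $e_\leq:P^2\to P$ is a fixed embedding of $(P;\leq)^2$ into $(P;\leq)$, i.e. injective with $e_\leq(a,b)\leq e_\leq(a',b')\iff(a\leq a'\wedge b\leq b')$. *)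

theory Defs
  imports Main "HOL-Library.Countable_Set"
begin

datatype fo = FLe nat nat | FEq nat nat | FNeg fo | FConj fo fo | FEx nat fo

fun fo_sat :: "('a \<Rightarrow> 'a \<Rightarrow> bool) \<Rightarrow> fo \<Rightarrow> (nat \<Rightarrow> 'a) \<Rightarrow> bool" where
  "fo_sat le (FLe i j) s = le (s i) (s j)"
| "fo_sat le (FEq i j) s = (s i = s j)"
| "fo_sat le (FNeg \<phi>) s = (\<not> fo_sat le \<phi> s)"
| "fo_sat le (FConj \<phi> \<psi>) s = (fo_sat le \<phi> s \<and> fo_sat le \<psi> s)"
| "fo_sat le (FEx v \<phi>) s = (\<exists>a. fo_sat le \<phi> (s(v := a)))"

fun fo_fv :: "fo \<Rightarrow> nat set" where
  "fo_fv (FLe i j) = {i, j}"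
| "fo_fv (FEq i j) = {i, j}"
| "fo_fv (FNeg \<phi>) = fo_fv \<phi>"
| "fo_fv (FConj \<phi> \<psi>) = fo_fv \<phi> \<union> fo_fv \<psi>"
| "fo_fv (FEx v \<phi>) = fo_fv \<phi> - {v}"

definition fo_definable :: "('a \<Rightarrow> 'a \<Rightarrow> bool) \<Rightarrow> nat \<Rightarrow> 'a list set \<Rightarrow> bool" where
  "fo_definable le n R \<longleftrightarrow>
     (\<exists>\<phi>. fo_fv \<phi> \<subseteq> {..<n} \<and>
          R = {xs. length xs = n \<and> fo_sat le \<phi> (\<lambda>i. xs ! i)})"

text \<open>A relational structure on the domain UNIV is given by a set of relations,
  each tagged with its arity.\<close>
type_synonym 'a rstruct = "(nat \<times> 'a list set) set"

definition is_reduct :: "('a \<Rightarrow> 'a \<Rightarrow> bool) \<Rightarrow> 'a rstruct \<Rightarrow> bool" where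
  "is_reduct le \<Gamma> \<longleftrightarrow>
     (\<forall>(n, R) \<in> \<Gamma>. R \<subseteq> {xs. length xs = n} \<and> fo_definable le n R)"

datatype 'a pp_atom = PEq nat nat | PRel "nat \<times> 'a list set" "nat list"

fun pp_atom_wf :: "'a rstruct \<Rightarrow> nat \<Rightarrow> 'a pp_atom \<Rightarrow> bool" where
  "pp_atom_wf \<Gamma> N (PEq i j) = (i < N \<and> j < N)"
| "pp_atom_wf \<Gamma> N (PRel (n, R) vs) =
     ((n, R) \<in> \<Gamma> \<and> length vs = n \<and> (\<forall>v \<in> set vs. v < N))"

fun pp_atom_holds :: "'a pp_atom \<Rightarrow> 'a list \<Rightarrow> bool" where
  "pp_atom_holds (PEq i j) zs = (zs ! i = zs ! j)"
| "pp_atom_holds (PRel (n, R) vs) zs = (map (\<lambda>v. zs ! v) vs \<in> R)"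

text \<open>S (of arity m) is defined by  \<exists>y_0..y_{k-1}. (conjunction of atoms) ,
  where the free variables are x_0..x_{m-1} (indices < m) and the
  quantified ones are y_j (index m + j).\<close>
definition pp_definable :: "'a rstruct \<Rightarrow> nat \<Rightarrow> 'a list set \<Rightarrow> bool" where
  "pp_definable \<Gamma> m S \<longleftrightarrow>
     (\<exists>k atoms. (\<forall>a \<in> set atoms. pp_atom_wf \<Gamma> (m + k) a) \<and>
        S = {xs. length xs = m \<and>
                 (\<exists>ys. length ys = k \<and> (\<forall>a \<in> set atoms. pp_atom_holds a (xs @ ys)))})"

definition Pol :: "'a rstruct \<Rightarrow> (nat \<times> ('a list \<Rightarrow> 'a)) set" where
  "Pol \<Gamma> = {(k, f). \<forall>(n, R) \<in> \<Gamma>. \<forall>ts. length ts = k \<and> set ts \<subseteq> R \<longrightarrow>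
                 map (\<lambda>i. f (map (\<lambda>t. t ! i) ts)) [0..<n] \<in> R}"

definition binop :: "('a \<Rightarrow> 'a \<Rightarrow> 'a) \<Rightarrow> (nat \<times> ('a list \<Rightarrow> 'a))" where
  "binop e = (2, \<lambda>xs. e (xs ! 0) (xs ! 1))"

definition partial_order_rel :: "('a \<Rightarrow> 'a \<Rightarrow> bool) \<Rightarrow> 'a set \<Rightarrow> bool" where
  "partial_order_rel le A \<longleftrightarrow>
     (\<forall>x\<in>A. le x x) \<and>
     (\<forall>x\<in>A. \<forall>y\<in>A. le x y \<and> le y x \<longrightarrow> x = y) \<and>
     (\<forall>x\<in>A. \<forall>y\<in>A. \<forall>z\<in>A. le x y \<and> le y z \<longrightarrow> le x z)"

text \<open>(UNIV; le) is the Fraisse limit of the class of all finite partial orders: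
  a countable partial order which is homogeneous and whose age consists of all
  finite partial orders.\<close>
definition random_poset :: "('a \<Rightarrow> 'a \<Rightarrow> bool) \<Rightarrow> bool" where
  "random_poset le \<longleftrightarrow>
     countable (UNIV :: 'a set) \<and>
     partial_order_rel le UNIV \<and>
     (\<forall>(n::nat) (r :: nat \<Rightarrow> nat \<Rightarrow> bool). partial_order_rel r {..<n} \<longrightarrow>
        (\<exists>f. inj_on f {..<n} \<and> (\<forall>i<n. \<forall>j<n. r i j \<longleftrightarrow> le (f i) (f j)))) \<and>
     (\<forall>A g. finite A \<and> inj_on g A \<and> (\<forall>x\<in>A. \<forall>y\<in>A. le x y \<longleftrightarrow> le (g x) (g y)) \<longrightarrow>
        (\<exists>h. bij h \<and> (\<forall>x y. le x y \<longleftrightarrow> le (h x) (h y)) \<and> (\<forall>x\<in>A. h x = g x)))"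

definition lt_of :: "('a \<Rightarrow> 'a \<Rightarrow> bool) \<Rightarrow> 'a \<Rightarrow> 'a \<Rightarrow> bool" where
  "lt_of le x y \<longleftrightarrow> le x y \<and> x \<noteq> y"

definition incomp :: "('a \<Rightarrow> 'a \<Rightarrow> bool) \<Rightarrow> 'a \<Rightarrow> 'a \<Rightarrow> bool" where
  "incomp le x y \<longleftrightarrow> \<not> le x y \<and> \<not> le y x"

definition LtRel :: "('a \<Rightarrow> 'a \<Rightarrow> bool) \<Rightarrow> 'a list set" where
  "LtRel le = {[x, y] | x y. lt_of le x y}"

definition IncompRel :: "('a \<Rightarrow> 'a \<Rightarrow> bool) \<Rightarrow> 'a list set" where
  "IncompRel le = {[x, y] | x y. incomp le x y}"

definition Low :: "('a \<Rightarrow> 'a \<Rightarrow> bool) \<Rightarrow> 'a list set" where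
  "Low le = {[x, y, z] | x y z.
      (lt_of le x y \<and> incomp le z x \<and> incomp le z y) \<or>
      (lt_of le x z \<and> incomp le y x \<and> incomp le y z)}"

definition emb_lt :: "('a \<Rightarrow> 'a \<Rightarrow> bool) \<Rightarrow> ('a \<Rightarrow> 'a \<Rightarrow> 'a) \<Rightarrow> bool" where
  "emb_lt le e \<longleftrightarrow> inj (\<lambda>(a, b). e a b) \<and>
     (\<forall>a b a' b'. lt_of le (e a b) (e a' b') \<longleftrightarrow> lt_of le a a' \<and> lt_of le b b')"

definition emb_le :: "('a \<Rightarrow> 'a \<Rightarrow> bool) \<Rightarrow> ('a \<Rightarrow> 'a \<Rightarrow> 'a) \<Rightarrow> bool" where
  "emb_le le e \<longleftrightarrow> inj (\<lambda>(a, b). e a b) \<and>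
     (\<forall>a b a' b'. le (e a b) (e a' b') \<longleftrightarrow> le a a' \<and> le b b')"

end

theory Submission
  imports Defs
begin

text \<open>
  Binary polymorphisms preserve \<open><\<close> and \<open>\<bottom>\<close>, hence send a pair of points of \<open>P\<^sup>2\<close> of type
  \<open>(<, \<bottom>)\<close> or \<open>(\<bottom>, <)\<close> to \<open><\<close> or \<open>\<bottom>\<close>; call a set of such pairs split by \<open>h\<close> if \<open>h\<close> makes all
  of them incomparable.  If \<open>Low\<close> is not pp-definable, compactness yields a binary polymorphism
  violating \<open>Low\<close>, which on three points either splits both a \<open>(<, \<bottom>)\<close> and a \<open>(\<bottom>, <)\<close> pair
  or splits neither.  Gluing finite configurations, in which a comparability at one place
  forces an incomparability at another, shows that any pair of type \<open>(<, \<bottom>)\<close> and any pair of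
  type \<open>(\<bottom>, <)\<close> can be split simultaneously; composing polymorphisms then splits any
  finite set of pairs.  So on each finite set some polymorphism \<open>h\<close> satisfies
  \<open>h p \<le> h q \<longrightarrow> p \<le> q\<close> componentwise, and only pairs of type \<open>(=, <)\<close> or \<open>(<, =)\<close> remain
  undetermined.  If one of these can always be made incomparable, composition makes all of them
  incomparable and \<open>e\<^sub><\<close> is a local limit of polymorphisms; otherwise all of them are forced
  to be comparable, which gives \<open>e\<^sub>\<le>\<close>.
\<close>

definition order_aut :: "('a \<Rightarrow> 'a \<Rightarrow> bool) \<Rightarrow> ('a \<Rightarrow> 'a) \<Rightarrow> bool" where
  "order_aut le h \<longleftrightarrow> bij h \<and> (\<forall>x y. le x y \<longleftrightarrow> le (h x) (h y))"

subsection \<open>Homogeneity and extension in the random partial order\<close>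

lemma Low_iff:
  "[x, y, z] \<in> Low le \<longleftrightarrow>
     (lt_of le x y \<and> incomp le z x \<and> incomp le z y) \<or>
     (lt_of le x z \<and> incomp le y x \<and> incomp le y z)"
  by (auto simp: Low_def)

locale random_order =
  fixes le :: "'a \<Rightarrow> 'a \<Rightarrow> bool"
  assumes random_poset: "random_poset le"
begin

abbreviation lt :: "'a \<Rightarrow> 'a \<Rightarrow> bool" where "lt \<equiv> lt_of le"
abbreviation inc :: "'a \<Rightarrow> 'a \<Rightarrow> bool" where "inc \<equiv> incomp le"

lemma partial_order: "partial_order_rel le UNIV"
  using random_poset by (simp add: random_poset_def)

lemma le_refl [simp]: "le x x"
  using partial_order by (simp add: partial_order_rel_def)

lemma le_antisym: "le x y \<Longrightarrow> le y x \<Longrightarrow> x = y"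
  using partial_order unfolding partial_order_rel_def by (metis UNIV_I)

lemma le_trans: "le x y \<Longrightarrow> le y z \<Longrightarrow> le x z"
  using partial_order unfolding partial_order_rel_def by (metis UNIV_I)

lemma countable_UNIV: "countable (UNIV :: 'a set)"
  using random_poset by (simp add: random_poset_def)

lemma finite_poset_embeds:
  assumes "partial_order_rel r {..<n::nat}"
  shows "\<exists>f. inj_on f {..<n} \<and> (\<forall>i<n. \<forall>j<n. r i j \<longleftrightarrow> le (f i) (f j))"
  using random_poset assms by (simp add: random_poset_def)

lemma homogeneous:
  assumes "finite A" "inj_on g A" "\<forall>x\<in>A. \<forall>y\<in>A. le x y \<longleftrightarrow> le (g x) (g y)"
  shows "\<exists>h. order_aut le h \<and> (\<forall>x\<in>A. h x = g x)"
  using random_poset assms by (simp add: random_poset_def order_aut_def)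

lemma lt_irrefl [simp]: "\<not> lt x x"
  by (simp add: lt_of_def)

lemma inc_irrefl [simp]: "\<not> inc x x"
  by (simp add: incomp_def)

lemma inc_sym: "inc x y \<Longrightarrow> inc y x"
  by (simp add: incomp_def)

lemma lt_imp_le: "lt x y \<Longrightarrow> le x y"
  by (simp add: lt_of_def)

lemma lt_trans: "lt x y \<Longrightarrow> lt y z \<Longrightarrow> lt x z"
  unfolding lt_of_def by (metis le_trans le_antisym)

lemma lt_le_trans: "lt x y \<Longrightarrow> le y z \<Longrightarrow> lt x z"
  unfolding lt_of_def by (metis le_trans le_antisym)

lemma le_lt_trans: "le x y \<Longrightarrow> lt y z \<Longrightarrow> lt x z"
  unfolding lt_of_def by (metis le_trans le_antisym)

lemma lt_not_le: "lt u v \<Longrightarrow> \<not> le v u"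
  unfolding lt_of_def by (metis le_antisym)

lemma lt_not_inc: "lt x y \<Longrightarrow> \<not> inc x y"
  by (simp add: lt_of_def incomp_def)

text \<open>Homogeneity stated for a finite relation. Applied to two pairs with equal first entries,
  \<open>iso\<close> gives \<open>le\<close> in both directions, so antisymmetry makes
  \<open>\<rho>\<close> a function, and likewise injective. Configurations can thus be listed
  without checking that their points are distinct.\<close>

lemma finite_iso_extends:
  assumes "finite \<rho>"
    and iso: "\<And>x x' y y'. (x, x') \<in> \<rho> \<Longrightarrow> (y, y') \<in> \<rho> \<Longrightarrow> le x y \<longleftrightarrow> le x' y'"
  obtains \<alpha> where "order_aut le \<alpha>" "\<And>x x'. (x, x') \<in> \<rho> \<Longrightarrow> \<alpha> x = x'"
proof -
  define g where "g x = (SOME x'. (x, x') \<in> \<rho>)" for x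
  have g: "g x = x'" if "(x, x') \<in> \<rho>" for x x'
  proof -
    have "(x, g x) \<in> \<rho>" unfolding g_def using that by (rule someI)
    then have "le (g x) x'" "le x' (g x)"
      using iso[OF _ that, of x "g x"] iso[OF that, of x "g x"] by simp_all
    then show ?thesis by (rule le_antisym)
  qed
  have le: "le x y \<longleftrightarrow> le (g x) (g y)" if xy: "x \<in> Domain \<rho>" "y \<in> Domain \<rho>" for x y
  proof -
    obtain x' y' where "(x, x') \<in> \<rho>" "(y, y') \<in> \<rho>" using xy by blast
    then show ?thesis using iso[of x x' y y'] g[of x x'] g[of y y'] by simp
  qed
  have "inj_on g (Domain \<rho>)"
  proof (rule inj_onI)
    fix x y assume "x \<in> Domain \<rho>" "y \<in> Domain \<rho>" "g x = g y"
    then have "le x y" "le y x" by (simp_all add: le)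
    then show "x = y" by (rule le_antisym)
  qed
  moreover have "\<forall>x\<in>Domain \<rho>. \<forall>y\<in>Domain \<rho>. le x y \<longleftrightarrow> le (g x) (g y)"
    using le by blast
  moreover have "finite (Domain \<rho>)" using assms(1) by (rule finite_Domain)
  ultimately obtain h where "order_aut le h" "\<forall>x\<in>Domain \<rho>. h x = g x"
    using homogeneous[of "Domain \<rho>" g] by blast
  then show thesis using that[of h] g by auto
qed

lemma realize_strict_order:
  assumes "trans E" "irrefl E"
  obtains f :: "nat \<Rightarrow> 'a" where
    "\<And>i j. i < n \<Longrightarrow> j < n \<Longrightarrow> lt (f i) (f j) \<longleftrightarrow> (i, j) \<in> E"
    "\<And>i j. i < n \<Longrightarrow> j < n \<Longrightarrow> inc (f i) (f j) \<longleftrightarrow> i \<noteq> j \<and> (i, j) \<notin> E \<and> (j, i) \<notin> E"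
proof -
  define r where "r i j \<longleftrightarrow> i = j \<or> (i, j) \<in> E" for i j
  have "partial_order_rel r {..<n}"
    unfolding partial_order_rel_def r_def
    using transD[OF assms(1)] assms(2) unfolding irrefl_def by (intro conjI; metis)
  then obtain f where f: "inj_on f {..<n}" "\<forall>i<n. \<forall>j<n. r i j \<longleftrightarrow> le (f i) (f j)"
    using finite_poset_embeds by blast
  have eq: "f i = f j \<longleftrightarrow> i = j" if "i < n" "j < n" for i j
    using f(1) that by (auto dest: inj_onD)
  have "(i, i) \<notin> E" for i using assms(2) by (simp add: irrefl_def)
  then show thesis
    using that[of f] f(2) eq unfolding lt_of_def incomp_def r_def by (metis (no_types, lifting))
qed

text \<open>A new point above the down-closure of \<open>D\<close> and below the up-closure of
  \<open>U\<close> gives a finite partial order, since \<open>D\<close> lies below \<open>U\<close>.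
  The age contains a copy of it, and an automorphism moves the copy of \<open>F\<close> back onto
  \<open>F\<close>, taking the new point along.\<close>

lemma one_point_extension:
  assumes "finite F" "D \<subseteq> F" "U \<subseteq> F" "\<And>d u. d \<in> D \<Longrightarrow> u \<in> U \<Longrightarrow> lt d u"
  obtains x where "x \<notin> F"
    "\<And>y. y \<in> F \<Longrightarrow> le y x \<longleftrightarrow> (\<exists>d\<in>D. le y d)"
    "\<And>y. y \<in> F \<Longrightarrow> le x y \<longleftrightarrow> (\<exists>u\<in>U. le u y)"
proof -
  obtain \<iota> n where \<iota>: "F = \<iota> ` {i::nat. i < n}" "inj_on \<iota> {i. i < n}"
    using finite_imp_nat_seg_image_inj_on[OF assms(1)] by metis
  define Dn where "Dn x \<longleftrightarrow> (\<exists>d\<in>D. le x d)" for x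
  define Up where "Up x \<longleftrightarrow> (\<exists>u\<in>U. le u x)" for x
  have Dn: "Dn x" if "le x y" "Dn y" for x y
    using that unfolding Dn_def by (metis le_trans)
  have Up: "Up y" if "le x y" "Up x" for x y
    using that unfolding Up_def by (metis le_trans)
  have Dn_Up: "lt x y" if "Dn x" "Up y" for x y
    using that assms(4) unfolding Dn_def Up_def by (metis le_lt_trans lt_le_trans)
  then have not_both: "\<not> (Dn x \<and> Up x)" for x using lt_irrefl by blast
  \<comment> \<open>Index \<open>n\<close> is the new point; the indices below \<open>n\<close>
    enumerate \<open>F\<close>.\<close>
  define r where "r i j \<longleftrightarrow> (if i < n then if j < n then le (\<iota> i) (\<iota> j) else Dn (\<iota> i)
      else if j < n then Up (\<iota> j) else True)" for i j
  have "i = j" if "i < Suc n" "j < Suc n" "r i j" "r j i" for i j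
  proof (cases "i < n \<and> j < n")
    case True
    then have "\<iota> i = \<iota> j" using that le_antisym[of "\<iota> i" "\<iota> j"] by (simp add: r_def)
    then show ?thesis using \<iota>(2) True by (simp add: inj_on_def)
  next
    case False
    then show ?thesis using that not_both[of "\<iota> i"] not_both[of "\<iota> j"]
      by (auto simp: r_def less_Suc_eq)
  qed
  moreover have "r i k" if "r i j" "r j k" for i j k
    using that le_trans[of "\<iota> i" "\<iota> j" "\<iota> k"] Dn[of "\<iota> i" "\<iota> j"] Up[of "\<iota> j" "\<iota> k"]
      Dn_Up[of "\<iota> i" "\<iota> k", THEN lt_imp_le] not_both[of "\<iota> j"]
    unfolding r_def by (cases "i < n"; cases "j < n"; cases "k < n") simp_all
  moreover have "r i i" for i by (simp add: r_def)
  ultimately have "partial_order_rel r {..<Suc n}"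
    unfolding partial_order_rel_def by (metis lessThan_iff)
  then obtain f where f: "inj_on f {..<Suc n}" "\<forall>i<Suc n. \<forall>j<Suc n. r i j \<longleftrightarrow> le (f i) (f j)"
    using finite_poset_embeds by blast
  define \<rho> where "\<rho> = (\<lambda>i. (f i, \<iota> i)) ` {..<n}"
  have "finite \<rho>" by (simp add: \<rho>_def)
  moreover have "le x y \<longleftrightarrow> le x' y'" if xy: "(x, x') \<in> \<rho>" "(y, y') \<in> \<rho>" for x x' y y'
  proof -
    obtain i j where "i < n" "j < n" "x = f i" "x' = \<iota> i" "y = f j" "y' = \<iota> j"
      using xy by (auto simp: \<rho>_def)
    then show ?thesis using f(2)[rule_format, of i j] by (simp add: r_def)
  qed
  ultimately obtain \<alpha> where \<alpha>: "order_aut le \<alpha>" "\<And>x x'. (x, x') \<in> \<rho> \<Longrightarrow> \<alpha> x = x'"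
    using finite_iso_extends[of \<rho>] by blast
  have \<alpha>f: "\<alpha> (f i) = \<iota> i" if "i < n" for i
    using that \<alpha>(2) by (simp add: \<rho>_def)
  have \<alpha>le: "le (\<alpha> x) (\<alpha> y) \<longleftrightarrow> le x y" "\<alpha> x = \<alpha> y \<longleftrightarrow> x = y" for x y
    using \<alpha>(1) by (simp_all add: order_aut_def bij_def inj_eq)
  have F: "\<exists>i<n. y = \<alpha> (f i) \<and> y = \<iota> i" if "y \<in> F" for y
    using that \<iota>(1) \<alpha>f by auto
  show thesis
  proof (rule that[of "\<alpha> (f n)"])
    show "\<alpha> (f n) \<notin> F"
    proof
      assume "\<alpha> (f n) \<in> F"
      then obtain i where i: "i < n" "f n = f i" using F \<alpha>le(2) by blast
      then have "n = i" using f(1) by (simp add: inj_on_def)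
      then show False using i(1) by simp
    qed
  next
    fix y assume "y \<in> F"
    then obtain i where i: "i < n" "y = \<alpha> (f i)" "y = \<iota> i" using F by blast
    show "le y (\<alpha> (f n)) \<longleftrightarrow> (\<exists>d\<in>D. le y d)"
      using f(2)[rule_format, of i n] i(1) unfolding i(2) \<alpha>le(1)
      by (simp add: r_def Dn_def i(2)[symmetric] i(3)[symmetric])
    show "le (\<alpha> (f n)) y \<longleftrightarrow> (\<exists>u\<in>U. le u y)"
      using f(2)[rule_format, of n i] i(1) unfolding i(2) \<alpha>le(1)
      by (simp add: r_def Up_def i(2)[symmetric] i(3)[symmetric])
  qed
qed

section \<open>Generic points over a finite set\<close>

lemma generic_below:
  assumes "finite F" "U \<subseteq> F"
  shows "\<exists>x. x \<notin> F \<and> (\<forall>y\<in>F. \<not> le y x \<and> (le x y \<longleftrightarrow> (\<exists>u\<in>U. le u y)))"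
  using assms by (rule_tac one_point_extension[of F "{}" U]) (assumption | blast)+

lemma generic_above:
  assumes "finite F" "D \<subseteq> F"
  shows "\<exists>x. x \<notin> F \<and> (\<forall>y\<in>F. \<not> le x y \<and> (le y x \<longleftrightarrow> (\<exists>d\<in>D. le y d)))"
  using assms by (rule_tac one_point_extension[of F D "{}"]) (assumption | blast)+

lemma below_avoiding:
  assumes "\<not> le p q"
  obtains x where "lt x p" "inc x q"
proof -
  have "finite {p, q}" "{p} \<subseteq> {p, q}" by simp_all
  from generic_below[OF this] obtain x where "x \<notin> {p, q}"
    "\<forall>y\<in>{p, q}. \<not> le y x \<and> (le x y \<longleftrightarrow> (\<exists>u\<in>{p}. le u y))"
    by blast
  then show thesis using that[of x] assms by (simp add: lt_of_def incomp_def)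
qed

lemma above_avoiding:
  assumes "\<not> le q p"
  obtains x where "lt p x" "inc x q"
proof -
  have "finite {p, q}" "{p} \<subseteq> {p, q}" by simp_all
  from generic_above[OF this] obtain x where "x \<notin> {p, q}"
    "\<forall>y\<in>{p, q}. \<not> le x y \<and> (le y x \<longleftrightarrow> (\<exists>d\<in>{p}. le y d))"
    by blast
  then show thesis using that[of x] assms by (auto simp: lt_of_def incomp_def)
qed

lemma below_exists: obtains x where "lt x p"
proof -
  have "finite {p}" "{p} \<subseteq> {p}" by simp_all
  from generic_below[OF this] obtain x where "x \<notin> {p}" "\<forall>y\<in>{p}. \<not> le y x \<and> (le x y \<longleftrightarrow> (\<exists>u\<in>{p}. le u y))"
    by blast
  then show thesis using that[of x] by (simp add: lt_of_def)
qed

text \<open>The worst position for two pairs is \<open>zigzag a b c d\<close> in the first and \<open>zigzag c d a b\<close> in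
  the second coordinate: then \<open>a < d\<close> and \<open>c < b\<close> hold in both.\<close>
definition zigzag :: "'a \<Rightarrow> 'a \<Rightarrow> 'a \<Rightarrow> 'a \<Rightarrow> bool" where
  "zigzag a b c d \<longleftrightarrow> lt a b \<and> lt a d \<and> lt c b \<and> inc c d \<and> inc a c \<and> inc b d"

text \<open>The points are added one at a time, each generic up to its prescribed comparabilities.
  Putting \<open>b\<close> above \<open>c\<close> and \<open>d\<close> above \<open>a\<close> gives
  the cross relations, while \<open>le c d\<close> would require \<open>le r s\<close>.\<close>

lemma zigzag_around:
  assumes "lt p q" "inc r s"
  obtains a b c d where "lt a p" "lt q b" "lt c r" "lt s d" "zigzag a b c d"
proof -
  let ?F = "{p, q, r, s}"
  have "finite ?F" "{p} \<subseteq> ?F" by simp_all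
  from generic_below[OF this] obtain a where a: "a \<notin> ?F"
      "\<forall>y\<in>?F. \<not> le y a \<and> (le a y \<longleftrightarrow> (\<exists>u\<in>{p}. le u y))"
    by blast
  have "finite (insert a ?F)" "{r} \<subseteq> insert a ?F" by simp_all
  from generic_below[OF this] obtain c where c: "c \<notin> insert a ?F"
      "\<forall>y\<in>insert a ?F. \<not> le y c \<and> (le c y \<longleftrightarrow> (\<exists>u\<in>{r}. le u y))"
    by blast
  let ?G = "insert c (insert a ?F)"
  have "finite ?G" "{q, c} \<subseteq> ?G" by simp_all
  from generic_above[OF this] obtain b where b: "b \<notin> ?G"
      "\<forall>y\<in>?G. \<not> le b y \<and> (le y b \<longleftrightarrow> (\<exists>d\<in>{q, c}. le y d))"
    by blast
  have "finite (insert b ?G)" "{s, a} \<subseteq> insert b ?G" by simp_all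
  from generic_above[OF this] obtain d where d: "d \<notin> insert b ?G"
      "\<forall>y\<in>insert b ?G. \<not> le d y \<and> (le y d \<longleftrightarrow> (\<exists>d\<in>{s, a}. le y d))"
    by blast
  have rs: "\<not> le r s" using assms(2) by (simp add: incomp_def)
  have "le a p" "le q b" "le c r" "le s d" "le c b" "le a d"
    using a(2) c(2) b(2) d(2) by auto
  moreover have "a \<noteq> p" "q \<noteq> b" "c \<noteq> r" "s \<noteq> d" "c \<noteq> b" "a \<noteq> d"
    using a(1) c(1) b(1) d(1) by auto
  ultimately have "lt a p" "lt q b" "lt c r" "lt s d" "lt c b" "lt a d"
    by (simp_all add: lt_of_def)
  moreover have "lt a b" using calculation assms(1) lt_trans by blast
  moreover have "\<not> le c a" "\<not> le a c" "\<not> le d b" "\<not> le b d" "\<not> le d c" "\<not> le c d"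
    using a(2) c(2) b(2) d(2) rs by auto
  ultimately show thesis using that[of a b c d] unfolding zigzag_def incomp_def by blast
qed

section \<open>Automorphisms matching small configurations\<close>

lemma zigzag_aut:
  assumes "zigzag a b c d" "zigzag a' b' c' d'"
  obtains \<alpha> where "order_aut le \<alpha>" "\<alpha> a = a'" "\<alpha> b = b'" "\<alpha> c = c'" "\<alpha> d = d'"
proof -
  let ?\<rho> = "{(a, a'), (b, b'), (c, c'), (d, d')}"
  have "\<forall>(x, x')\<in>?\<rho>. \<forall>(y, y')\<in>?\<rho>. le x y \<longleftrightarrow> le x' y'"
    using assms lt_not_le[of a b] lt_not_le[of a d] lt_not_le[of c b]
      lt_not_le[of a' b'] lt_not_le[of a' d'] lt_not_le[of c' b']
    unfolding zigzag_def by (simp add: incomp_def lt_imp_le)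
  then have "le x y \<longleftrightarrow> le x' y'" if "(x, x') \<in> ?\<rho>" "(y, y') \<in> ?\<rho>" for x x' y y'
    using that by blast
  then obtain \<alpha> where "order_aut le \<alpha>" "\<And>x x'. (x, x') \<in> ?\<rho> \<Longrightarrow> \<alpha> x = x'"
    using finite_iso_extends[of ?\<rho>] by blast
  then show thesis using that[of \<alpha>] by simp
qed

text \<open>Used as \<open>free_pair p q r s\<close> in the first coordinate and
  \<open>free_pair r s p q\<close> in the second: the two pairs then have no comparabilities beyond
  those that their types (<, incomparable) and (incomparable, <) demand.\<close>

definition free_pair :: "'a \<Rightarrow> 'a \<Rightarrow> 'a \<Rightarrow> 'a \<Rightarrow> bool" where
  "free_pair p q r s \<longleftrightarrow> lt p q \<and> inc p r \<and> inc p s \<and> inc q r \<and> inc q s \<and> inc r s"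

lemma free_pair_aut:
  assumes "free_pair a b c d" "free_pair a' b' c' d'"
  obtains \<alpha> where "order_aut le \<alpha>" "\<alpha> a = a'" "\<alpha> b = b'" "\<alpha> c = c'" "\<alpha> d = d'"
proof -
  let ?\<rho> = "{(a, a'), (b, b'), (c, c'), (d, d')}"
  have "\<forall>(x, x')\<in>?\<rho>. \<forall>(y, y')\<in>?\<rho>. le x y \<longleftrightarrow> le x' y'"
    using assms lt_not_le[of a b] lt_not_le[of a' b']
    unfolding free_pair_def by (simp add: incomp_def lt_imp_le)
  then have "le x y \<longleftrightarrow> le x' y'" if "(x, x') \<in> ?\<rho>" "(y, y') \<in> ?\<rho>" for x x' y y'
    using that by blast
  then obtain \<alpha> where "order_aut le \<alpha>" "\<And>x x'. (x, x') \<in> ?\<rho> \<Longrightarrow> \<alpha> x = x'"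
    using finite_iso_extends[of ?\<rho>] by blast
  then show thesis using that[of \<alpha>] by simp
qed

lemma lt_inc_aut:
  assumes "lt a b" "inc c a" "inc c b" "lt a' b'" "inc c' a'" "inc c' b'"
  obtains \<alpha> where "order_aut le \<alpha>" "\<alpha> a = a'" "\<alpha> b = b'" "\<alpha> c = c'"
proof -
  let ?\<rho> = "{(a, a'), (b, b'), (c, c')}"
  have "\<forall>(x, x')\<in>?\<rho>. \<forall>(y, y')\<in>?\<rho>. le x y \<longleftrightarrow> le x' y'"
    using assms lt_not_le[of a b] lt_not_le[of a' b'] by (simp add: incomp_def lt_imp_le)
  then have "le x y \<longleftrightarrow> le x' y'" if "(x, x') \<in> ?\<rho>" "(y, y') \<in> ?\<rho>" for x x' y y'
    using that by blast
  then obtain \<alpha> where "order_aut le \<alpha>" "\<And>x x'. (x, x') \<in> ?\<rho> \<Longrightarrow> \<alpha> x = x'"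
    using finite_iso_extends[of ?\<rho>] by blast
  then show thesis using that[of \<alpha>] by simp
qed

lemma lt_aut:
  assumes "lt a b" "lt a' b'"
  obtains \<alpha> where "order_aut le \<alpha>" "\<alpha> a = a'" "\<alpha> b = b'"
proof -
  let ?\<rho> = "{(a, a'), (b, b')}"
  have "\<forall>(x, x')\<in>?\<rho>. \<forall>(y, y')\<in>?\<rho>. le x y \<longleftrightarrow> le x' y'"
    using assms lt_not_le[of a b] lt_not_le[of a' b'] by (simp add: lt_imp_le)
  then have "le x y \<longleftrightarrow> le x' y'" if "(x, x') \<in> ?\<rho>" "(y, y') \<in> ?\<rho>" for x x' y y'
    using that by blast
  then obtain \<alpha> where "order_aut le \<alpha>" "\<And>x x'. (x, x') \<in> ?\<rho> \<Longrightarrow> \<alpha> x = x'"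
    using finite_iso_extends[of ?\<rho>] by blast
  then show thesis using that[of \<alpha>] by simp
qed

lemma point_aut: obtains \<alpha> where "order_aut le \<alpha>" "\<alpha> a = a'"
proof -
  have "le x y \<longleftrightarrow> le x' y'" if "(x, x') \<in> {(a, a')}" "(y, y') \<in> {(a, a')}" for x x' y y'
    using that by simp
  then obtain \<alpha> where "order_aut le \<alpha>" "\<And>x x'. (x, x') \<in> {(a, a')} \<Longrightarrow> \<alpha> x = x'"
    using finite_iso_extends[of "{(a, a')}"] by blast
  then show thesis using that[of \<alpha>] by simp
qed

text \<open>Irreflexivity and transitivity are phrased with quantifiers bounded by the relations, so
  that \<open>simp\<close> decides them for explicit finite sets. A configuration in the square is
  then given by listing its edges in each coordinate.\<close>

lemma realize_two_orders:
  fixes E1 E2 :: "(nat \<times> nat) set"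
  assumes "\<forall>(i, j)\<in>E1. i \<noteq> j \<and> (\<forall>(k, l)\<in>E1. j = k \<longrightarrow> (i, l) \<in> E1)"
    and "\<forall>(i, j)\<in>E2. i \<noteq> j \<and> (\<forall>(k, l)\<in>E2. j = k \<longrightarrow> (i, l) \<in> E2)"
  obtains z :: "nat \<Rightarrow> 'a \<times> 'a" where
    "\<And>i j. i < n \<Longrightarrow> j < n \<Longrightarrow> lt (fst (z i)) (fst (z j)) \<longleftrightarrow> (i, j) \<in> E1"
    "\<And>i j. i < n \<Longrightarrow> j < n \<Longrightarrow>
       inc (fst (z i)) (fst (z j)) \<longleftrightarrow> i \<noteq> j \<and> (i, j) \<notin> E1 \<and> (j, i) \<notin> E1"
    "\<And>i j. i < n \<Longrightarrow> j < n \<Longrightarrow> lt (snd (z i)) (snd (z j)) \<longleftrightarrow> (i, j) \<in> E2"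
    "\<And>i j. i < n \<Longrightarrow> j < n \<Longrightarrow>
       inc (snd (z i)) (snd (z j)) \<longleftrightarrow> i \<noteq> j \<and> (i, j) \<notin> E2 \<and> (j, i) \<notin> E2"
proof -
  have "trans E1" "irrefl E1" using assms(1) by (auto intro!: transI irreflI)
  from realize_strict_order[OF this, of n] obtain x where
    x: "\<And>i j. i < n \<Longrightarrow> j < n \<Longrightarrow> lt (x i) (x j) \<longleftrightarrow> (i, j) \<in> E1"
      "\<And>i j. i < n \<Longrightarrow> j < n \<Longrightarrow> inc (x i) (x j) \<longleftrightarrow> i \<noteq> j \<and> (i, j) \<notin> E1 \<and> (j, i) \<notin> E1"
    by blast
  have "trans E2" "irrefl E2" using assms(2) by (auto intro!: transI irreflI)
  from realize_strict_order[OF this, of n] obtain y where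
    y: "\<And>i j. i < n \<Longrightarrow> j < n \<Longrightarrow> lt (y i) (y j) \<longleftrightarrow> (i, j) \<in> E2"
      "\<And>i j. i < n \<Longrightarrow> j < n \<Longrightarrow> inc (y i) (y j) \<longleftrightarrow> i \<noteq> j \<and> (i, j) \<notin> E2 \<and> (j, i) \<notin> E2"
    by blast
  show thesis by (rule that[of "\<lambda>i. (x i, y i)"]) (simp_all add: x y)
qed

lemma order_aut_le: "order_aut le \<alpha> \<Longrightarrow> le (\<alpha> x) (\<alpha> y) \<longleftrightarrow> le x y"
  by (simp add: order_aut_def)

lemma order_aut_id: "order_aut le (\<lambda>x. x)"
  by (simp add: order_aut_def bij_betw_def inj_on_def)

end

subsection \<open>Binary operations preserving order and incomparability\<close>

text \<open>Models the binary part of a polymorphism clone, with operations taking a point of the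
  square. Automorphisms enter through the two projections, and \<open>comp\<close> turns them into
  independent changes of coordinates (\<open>aut_mem\<close>).\<close>

locale order_clone = random_order le for le :: "'a \<Rightarrow> 'a \<Rightarrow> bool" +
  fixes C :: "('a \<times> 'a \<Rightarrow> 'a) set"
  assumes proj1: "order_aut le \<alpha> \<Longrightarrow> (\<lambda>p. \<alpha> (fst p)) \<in> C"
    and proj2: "order_aut le \<alpha> \<Longrightarrow> (\<lambda>p. \<alpha> (snd p)) \<in> C"
    and comp: "h \<in> C \<Longrightarrow> u \<in> C \<Longrightarrow> v \<in> C \<Longrightarrow> (\<lambda>p. h (u p, v p)) \<in> C"
    and pres_lt: "h \<in> C \<Longrightarrow> lt (fst p) (fst q) \<Longrightarrow> lt (snd p) (snd q) \<Longrightarrow> lt (h p) (h q)"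
    and pres_inc: "h \<in> C \<Longrightarrow> inc (fst p) (fst q) \<Longrightarrow> inc (snd p) (snd q) \<Longrightarrow> inc (h p) (h q)"
begin

lemma fst_mem: "fst \<in> C"
  using proj1[OF order_aut_id] by (simp add: eta_contract_eq)

lemma snd_mem: "snd \<in> C"
  using proj2[OF order_aut_id] by (simp add: eta_contract_eq)

lemma swap_mem: "h \<in> C \<Longrightarrow> (\<lambda>p. h (snd p, fst p)) \<in> C"
  using comp[OF _ snd_mem fst_mem] .

lemma aut_mem:
  "h \<in> C \<Longrightarrow> order_aut le \<alpha> \<Longrightarrow> order_aut le \<beta> \<Longrightarrow> (\<lambda>p. h (\<alpha> (fst p), \<beta> (snd p))) \<in> C"
  using comp[OF _ proj1 proj2] .

text \<open>A point \<open>d\<close> above \<open>p\<close> and incomparable to \<open>q\<close> in both coordinates satisfies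
  \<open>h p < h d\<close> and \<open>h d \<bottom> h q\<close>, which excludes \<open>h q \<le> h p\<close>.\<close>
lemma lt_inc_cases:
  assumes "h \<in> C" "lt (fst p) (fst q)" "inc (snd p) (snd q)"
  shows "lt (h p) (h q) \<or> inc (h p) (h q)"
proof (rule ccontr)
  assume "\<not> ?thesis"
  then have qp: "le (h q) (h p)" by (auto simp: lt_of_def incomp_def)
  have "\<not> le (fst q) (fst p)" "\<not> le (snd q) (snd p)"
    using assms(3) lt_not_le[OF assms(2)] by (simp_all add: incomp_def)
  then obtain d1 d2 where d: "lt (fst p) d1" "inc d1 (fst q)" "lt (snd p) d2" "inc d2 (snd q)"
    using above_avoiding by metis
  have "lt (h p) (h (d1, d2))" "inc (h (d1, d2)) (h q)"
    using pres_lt[OF assms(1)] pres_inc[OF assms(1)] d by simp_all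
  with qp show False using le_lt_trans lt_not_inc inc_sym by blast
qed

lemma inc_lt_cases:
  assumes "h \<in> C" "inc (fst p) (fst q)" "lt (snd p) (snd q)"
  shows "lt (h p) (h q) \<or> inc (h p) (h q)"
  using lt_inc_cases[OF swap_mem[OF assms(1)], of "(snd p, fst p)" "(snd q, fst q)"] assms(2,3)
  by simp

text \<open>Each of the two comparisons with the image of the first point is < or incomparable, and
  the other two images are incomparable to each other. If exactly one comparison were <, the image
  would lie in \<open>Low\<close>.\<close>

lemma Low_violation_cases:
  assumes "h \<in> C" "lt a b" "inc c a" "inc c b" "lt a' c'" "inc b' a'" "inc b' c'"
    and "[h (a, a'), h (b, b'), h (c, c')] \<notin> Low le"
  shows "inc (h (a, a')) (h (b, b')) \<and> inc (h (a, a')) (h (c, c')) \<or>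
         lt (h (a, a')) (h (b, b')) \<and> lt (h (a, a')) (h (c, c'))"
proof -
  have "lt (h (a, a')) (h (b, b')) \<or> inc (h (a, a')) (h (b, b'))"
    using lt_inc_cases[OF assms(1), of "(a, a')" "(b, b')"] assms inc_sym by simp
  moreover have "lt (h (a, a')) (h (c, c')) \<or> inc (h (a, a')) (h (c, c'))"
    using inc_lt_cases[OF assms(1), of "(a, a')" "(c, c')"] assms inc_sym by simp
  moreover have "inc (h (b, b')) (h (c, c'))"
    using pres_inc[OF assms(1), of "(b, b')" "(c, c')"] assms inc_sym by simp
  ultimately show ?thesis using assms(8) inc_sym unfolding Low_iff by blast
qed

text \<open>The points \<open>0, 1, 2\<close> play the roles of \<open>a, b, c\<close>.  The pair \<open>3, 4\<close> lies between
  \<open>0\<close> and \<open>1\<close>, and \<open>5, 6\<close> between \<open>0\<close> and \<open>2\<close>, in both coordinates, so they inherit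
  incomparability.\<close>
lemma free_good_of_inc:
  assumes "h \<in> C" "lt a b" "inc c a" "inc c b" "lt a' c'" "inc b' a'" "inc b' c'"
    and "inc (h (a, a')) (h (b, b'))" "inc (h (a, a')) (h (c, c'))"
  shows "\<exists>g\<in>C. \<exists>p q r s. free_pair (fst p) (fst q) (fst r) (fst s) \<and>
           free_pair (snd r) (snd s) (snd p) (snd q) \<and> inc (g p) (g q) \<and> inc (g r) (g s)"
proof -
  define E1 :: "(nat \<times> nat) set" where
    "E1 = {(0,3),(0,4),(0,1),(0,5),(3,4),(3,1),(4,1),(6,2)}"
  define E2 :: "(nat \<times> nat) set" where
    "E2 = {(0,5),(0,6),(0,2),(5,6),(5,2),(6,2),(0,3),(4,1)}"
  have "\<forall>(i, j)\<in>E1. i \<noteq> j \<and> (\<forall>(k, l)\<in>E1. j = k \<longrightarrow> (i, l) \<in> E1)"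
      "\<forall>(i, j)\<in>E2. i \<noteq> j \<and> (\<forall>(k, l)\<in>E2. j = k \<longrightarrow> (i, l) \<in> E2)"
    by (simp_all add: E1_def E2_def)
  from realize_two_orders[OF this, of 7] obtain z where z:
      "\<And>i j. i < 7 \<Longrightarrow> j < 7 \<Longrightarrow> lt (fst (z i)) (fst (z j)) \<longleftrightarrow> (i, j) \<in> E1"
      "\<And>i j. i < 7 \<Longrightarrow> j < 7 \<Longrightarrow>
         inc (fst (z i)) (fst (z j)) \<longleftrightarrow> i \<noteq> j \<and> (i, j) \<notin> E1 \<and> (j, i) \<notin> E1"
      "\<And>i j. i < 7 \<Longrightarrow> j < 7 \<Longrightarrow> lt (snd (z i)) (snd (z j)) \<longleftrightarrow> (i, j) \<in> E2"
      "\<And>i j. i < 7 \<Longrightarrow> j < 7 \<Longrightarrow>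
         inc (snd (z i)) (snd (z j)) \<longleftrightarrow> i \<noteq> j \<and> (i, j) \<notin> E2 \<and> (j, i) \<notin> E2"
    by blast
  have "lt (fst (z 0)) (fst (z 1))" "inc (fst (z 2)) (fst (z 0))" "inc (fst (z 2)) (fst (z 1))"
    by (simp_all add: z E1_def E2_def)
  from lt_inc_aut[OF this assms(2-4)] obtain \<alpha> where
    \<alpha>: "order_aut le \<alpha>" "\<alpha> (fst (z 0)) = a" "\<alpha> (fst (z 1)) = b" "\<alpha> (fst (z 2)) = c" .
  have "lt (snd (z 0)) (snd (z 2))" "inc (snd (z 1)) (snd (z 0))" "inc (snd (z 1)) (snd (z 2))"
    by (simp_all add: z E1_def E2_def)
  from lt_inc_aut[OF this assms(5-7)] obtain \<beta> where
    \<beta>: "order_aut le \<beta>" "\<beta> (snd (z 0)) = a'" "\<beta> (snd (z 2)) = c'" "\<beta> (snd (z 1)) = b'" .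
  \<comment> \<open>The coordinates are moved independently, so \<open>g\<close> takes at
    \<open>z 0\<close>, \<open>z 1\<close>, \<open>z 2\<close> the values of \<open>h\<close> at
    \<open>(a, a')\<close>, \<open>(b, b')\<close>, \<open>(c, c')\<close>.\<close>
  define g where "g p = h (\<alpha> (fst p), \<beta> (snd p))" for p
  have g: "g \<in> C" unfolding g_def using aut_mem[OF assms(1) \<alpha>(1) \<beta>(1)] .
  have gz: "inc (g (z 0)) (g (z 1))" "inc (g (z 0)) (g (z 2))"
    using assms(8,9) by (simp_all add: g_def \<alpha> \<beta> del: One_nat_def)
  have "lt (g (z 0)) (g (z 3))" "lt (g (z 4)) (g (z 1))" "lt (g (z 0)) (g (z 5))"
      "lt (g (z 6)) (g (z 2))"
    by (rule pres_lt[OF g]; simp add: z E1_def E2_def)+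
  then have "\<not> lt (g (z 3)) (g (z 4))" "\<not> lt (g (z 5)) (g (z 6))"
    using gz lt_trans lt_not_inc by blast+
  then have "inc (g (z 3)) (g (z 4))" "inc (g (z 5)) (g (z 6))"
    using lt_inc_cases[OF g, of "z 3" "z 4"] inc_lt_cases[OF g, of "z 5" "z 6"]
    by (simp_all add: z E1_def E2_def)
  moreover have "free_pair (fst (z 3)) (fst (z 4)) (fst (z 5)) (fst (z 6))"
      "free_pair (snd (z 5)) (snd (z 6)) (snd (z 3)) (snd (z 4))"
    by (simp_all add: free_pair_def z E1_def E2_def)
  ultimately show ?thesis using g by blast
qed

text \<open>Again \<open>0, 1, 2\<close> are \<open>a, b, c\<close>.  Now \<open>4\<close> and \<open>6\<close> lie below \<open>0\<close> while \<open>3 \<bottom> 2\<close> and \<open>5 \<bottom> 1\<close>,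
  so \<open>3 < 4\<close> or \<open>5 < 6\<close> in the image would contradict transitivity.\<close>
lemma free_good_of_lt:
  assumes "h \<in> C" "lt a b" "inc c a" "inc c b" "lt a' c'" "inc b' a'" "inc b' c'"
    and "lt (h (a, a')) (h (b, b'))" "lt (h (a, a')) (h (c, c'))"
  shows "\<exists>g\<in>C. \<exists>p q r s. free_pair (fst p) (fst q) (fst r) (fst s) \<and>
           free_pair (snd r) (snd s) (snd p) (snd q) \<and> inc (g p) (g q) \<and> inc (g r) (g s)"
proof -
  define E1 :: "(nat \<times> nat) set" where
    "E1 = {(3,4),(3,0),(3,1),(4,0),(4,1),(0,1),(6,0),(6,1)}"
  define E2 :: "(nat \<times> nat) set" where
    "E2 = {(5,6),(5,0),(5,2),(6,0),(6,2),(0,2),(4,0),(4,2)}"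
  have "\<forall>(i, j)\<in>E1. i \<noteq> j \<and> (\<forall>(k, l)\<in>E1. j = k \<longrightarrow> (i, l) \<in> E1)"
      "\<forall>(i, j)\<in>E2. i \<noteq> j \<and> (\<forall>(k, l)\<in>E2. j = k \<longrightarrow> (i, l) \<in> E2)"
    by (simp_all add: E1_def E2_def)
  from realize_two_orders[OF this, of 7] obtain z where z:
      "\<And>i j. i < 7 \<Longrightarrow> j < 7 \<Longrightarrow> lt (fst (z i)) (fst (z j)) \<longleftrightarrow> (i, j) \<in> E1"
      "\<And>i j. i < 7 \<Longrightarrow> j < 7 \<Longrightarrow>
         inc (fst (z i)) (fst (z j)) \<longleftrightarrow> i \<noteq> j \<and> (i, j) \<notin> E1 \<and> (j, i) \<notin> E1"
      "\<And>i j. i < 7 \<Longrightarrow> j < 7 \<Longrightarrow> lt (snd (z i)) (snd (z j)) \<longleftrightarrow> (i, j) \<in> E2"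
      "\<And>i j. i < 7 \<Longrightarrow> j < 7 \<Longrightarrow>
         inc (snd (z i)) (snd (z j)) \<longleftrightarrow> i \<noteq> j \<and> (i, j) \<notin> E2 \<and> (j, i) \<notin> E2"
    by blast
  have "lt (fst (z 0)) (fst (z 1))" "inc (fst (z 2)) (fst (z 0))" "inc (fst (z 2)) (fst (z 1))"
    by (simp_all add: z E1_def E2_def)
  from lt_inc_aut[OF this assms(2-4)] obtain \<alpha> where
    \<alpha>: "order_aut le \<alpha>" "\<alpha> (fst (z 0)) = a" "\<alpha> (fst (z 1)) = b" "\<alpha> (fst (z 2)) = c" .
  have "lt (snd (z 0)) (snd (z 2))" "inc (snd (z 1)) (snd (z 0))" "inc (snd (z 1)) (snd (z 2))"
    by (simp_all add: z E1_def E2_def)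
  from lt_inc_aut[OF this assms(5-7)] obtain \<beta> where
    \<beta>: "order_aut le \<beta>" "\<beta> (snd (z 0)) = a'" "\<beta> (snd (z 2)) = c'" "\<beta> (snd (z 1)) = b'" .
  define g where "g p = h (\<alpha> (fst p), \<beta> (snd p))" for p
  have g: "g \<in> C" unfolding g_def using aut_mem[OF assms(1) \<alpha>(1) \<beta>(1)] .
  have gz: "lt (g (z 0)) (g (z 1))" "lt (g (z 0)) (g (z 2))"
    using assms(8,9) by (simp_all add: g_def \<alpha> \<beta> del: One_nat_def)
  have "lt (g (z 4)) (g (z 0))" "lt (g (z 6)) (g (z 0))"
    by (rule pres_lt[OF g]; simp add: z E1_def E2_def)+
  moreover have "inc (g (z 3)) (g (z 2))" "inc (g (z 5)) (g (z 1))"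
    by (rule pres_inc[OF g]; simp add: z E1_def E2_def)+
  ultimately have "\<not> lt (g (z 3)) (g (z 4))" "\<not> lt (g (z 5)) (g (z 6))"
    using gz lt_trans lt_not_inc by blast+
  then have "inc (g (z 3)) (g (z 4))" "inc (g (z 5)) (g (z 6))"
    using lt_inc_cases[OF g, of "z 3" "z 4"] inc_lt_cases[OF g, of "z 5" "z 6"]
    by (simp_all add: z E1_def E2_def)
  moreover have "free_pair (fst (z 3)) (fst (z 4)) (fst (z 5)) (fst (z 6))"
      "free_pair (snd (z 5)) (snd (z 6)) (snd (z 3)) (snd (z 4))"
    by (simp_all add: free_pair_def z E1_def E2_def)
  ultimately show ?thesis using g by blast
qed

text \<open>Three zigzags \<open>(0, 1, 2, 3)\<close>, \<open>(3, 4, 6, 5)\<close>, \<open>(7, 6, 8, 9)\<close> in a row, with the outer pairs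
  \<open>0, 1\<close> and \<open>8, 9\<close> in free position and thus split.  Since \<open>2 \<bottom> 4\<close> and \<open>7 \<bottom> 5\<close>,
  not both \<open>2 < 3 < 4\<close>, and not both \<open>7 < 6 < 5\<close>, in the image; so one of the three zigzags
  has both of its pairs split.\<close>
lemma zigzag_good_of_free_good:
  assumes h: "h \<in> C" and pqrs: "free_pair (fst p) (fst q) (fst r) (fst s)"
      "free_pair (snd r) (snd s) (snd p) (snd q)" "inc (h p) (h q)" "inc (h r) (h s)"
  shows "\<exists>g\<in>C. \<exists>a b c d. zigzag (fst a) (fst b) (fst c) (fst d) \<and>
           zigzag (snd c) (snd d) (snd a) (snd b) \<and> inc (g a) (g b) \<and> inc (g c) (g d)"
proof -
  define E1 :: "(nat \<times> nat) set" where
    "E1 = {(0,1),(0,3),(2,1),(8,6),(7,6),(7,9),(3,4),(6,4),(3,5),(0,4),(0,5),(8,4),(7,4)}"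
  define E2 :: "(nat \<times> nat) set" where
    "E2 = {(2,3),(2,1),(0,3),(8,9),(8,6),(7,9),(6,4),(6,5),(3,5),(2,5),(0,5),(8,4),(8,5)}"
  have "\<forall>(i, j)\<in>E1. i \<noteq> j \<and> (\<forall>(k, l)\<in>E1. j = k \<longrightarrow> (i, l) \<in> E1)"
      "\<forall>(i, j)\<in>E2. i \<noteq> j \<and> (\<forall>(k, l)\<in>E2. j = k \<longrightarrow> (i, l) \<in> E2)"
    by (simp_all add: E1_def E2_def)
  from realize_two_orders[OF this, of 10] obtain z where z:
      "\<And>i j. i < 10 \<Longrightarrow> j < 10 \<Longrightarrow> lt (fst (z i)) (fst (z j)) \<longleftrightarrow> (i, j) \<in> E1"
      "\<And>i j. i < 10 \<Longrightarrow> j < 10 \<Longrightarrow>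
         inc (fst (z i)) (fst (z j)) \<longleftrightarrow> i \<noteq> j \<and> (i, j) \<notin> E1 \<and> (j, i) \<notin> E1"
      "\<And>i j. i < 10 \<Longrightarrow> j < 10 \<Longrightarrow> lt (snd (z i)) (snd (z j)) \<longleftrightarrow> (i, j) \<in> E2"
      "\<And>i j. i < 10 \<Longrightarrow> j < 10 \<Longrightarrow>
         inc (snd (z i)) (snd (z j)) \<longleftrightarrow> i \<noteq> j \<and> (i, j) \<notin> E2 \<and> (j, i) \<notin> E2"
    by blast
  have "free_pair (fst (z 0)) (fst (z 1)) (fst (z 8)) (fst (z 9))" by (simp add: free_pair_def z E1_def E2_def)
  from free_pair_aut[OF this pqrs(1)] obtain \<alpha> where
    \<alpha>: "order_aut le \<alpha>" "\<alpha> (fst (z 0)) = fst p" "\<alpha> (fst (z 1)) = fst q" "\<alpha> (fst (z 8)) = fst r" "\<alpha> (fst (z 9)) = fst s" .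
  have "free_pair (snd (z 8)) (snd (z 9)) (snd (z 0)) (snd (z 1))" by (simp add: free_pair_def z E1_def E2_def)
  from free_pair_aut[OF this pqrs(2)] obtain \<beta> where
    \<beta>: "order_aut le \<beta>" "\<beta> (snd (z 8)) = snd r" "\<beta> (snd (z 9)) = snd s" "\<beta> (snd (z 0)) = snd p" "\<beta> (snd (z 1)) = snd q" .
  define g where "g p = h (\<alpha> (fst p), \<beta> (snd p))" for p
  have g: "g \<in> C" unfolding g_def using aut_mem[OF h \<alpha>(1) \<beta>(1)] .
  have ends: "inc (g (z 0)) (g (z 1))" "inc (g (z 8)) (g (z 9))"
    using pqrs(3,4) by (simp_all add: g_def \<alpha> \<beta> del: One_nat_def)
  have cells:
    "zigzag (fst (z 0)) (fst (z 1)) (fst (z 2)) (fst (z 3))"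
    "zigzag (snd (z 2)) (snd (z 3)) (snd (z 0)) (snd (z 1))"
    "zigzag (fst (z 3)) (fst (z 4)) (fst (z 6)) (fst (z 5))"
    "zigzag (snd (z 6)) (snd (z 5)) (snd (z 3)) (snd (z 4))"
    "zigzag (fst (z 7)) (fst (z 6)) (fst (z 8)) (fst (z 9))"
    "zigzag (snd (z 8)) (snd (z 9)) (snd (z 7)) (snd (z 6))"
    by (simp_all add: zigzag_def z E1_def E2_def)
  have "inc (g (z 2)) (g (z 4))" "inc (g (z 7)) (g (z 5))"
    by (rule pres_inc[OF g]; simp add: z E1_def E2_def)+
  then have links: "\<not> (lt (g (z 2)) (g (z 3)) \<and> lt (g (z 3)) (g (z 4)))"
      "\<not> (lt (g (z 7)) (g (z 6)) \<and> lt (g (z 6)) (g (z 5)))"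
    using lt_trans lt_not_inc by blast+
  have "lt (g (z 2)) (g (z 3)) \<or> inc (g (z 2)) (g (z 3))"
      "lt (g (z 6)) (g (z 5)) \<or> inc (g (z 6)) (g (z 5))"
    by (rule inc_lt_cases[OF g]; simp add: z E1_def E2_def)+
  moreover have "lt (g (z 3)) (g (z 4)) \<or> inc (g (z 3)) (g (z 4))"
      "lt (g (z 7)) (g (z 6)) \<or> inc (g (z 7)) (g (z 6))"
    by (rule lt_inc_cases[OF g]; simp add: z E1_def E2_def)+
  ultimately consider "inc (g (z 2)) (g (z 3))"
    | "inc (g (z 3)) (g (z 4))" "inc (g (z 6)) (g (z 5))"
    | "inc (g (z 7)) (g (z 6))"
    using links by blast
  then show ?thesis using g ends cells by cases blast+
qed

end

subsection \<open>Consequences of violating Low\<close>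

text \<open>The two rows satisfy different disjuncts of \<open>Low\<close>. Two rows satisfying the
  same disjunct cannot be mapped out of \<open>Low\<close>, by \<open>pres_lt\<close> and
  \<open>pres_inc\<close>.\<close>

locale low_violating_clone = order_clone +
  fixes f a b c a' b' c'
  assumes f: "f \<in> C" "lt a b" "inc c a" "inc c b" "lt a' c'" "inc b' a'" "inc b' c'"
    and not_Low: "[f (a, a'), f (b, b'), f (c, c')] \<notin> Low le"
begin

lemma zigzag_good:
  "\<exists>g\<in>C. \<exists>a b c d. zigzag (fst a) (fst b) (fst c) (fst d) \<and>
     zigzag (snd c) (snd d) (snd a) (snd b) \<and> inc (g a) (g b) \<and> inc (g c) (g d)"
  using Low_violation_cases[OF f not_Low] free_good_of_inc[OF f] free_good_of_lt[OF f]
    zigzag_good_of_free_good by blast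

text \<open>Squeezing: \<open>a < p\<close>, \<open>q < b\<close> and \<open>h a \<bottom> h b\<close> exclude \<open>h p < h q\<close>.\<close>
lemma two_pairs_inc:
  assumes "lt (fst p) (fst q)" "inc (snd p) (snd q)" "inc (fst r) (fst s)" "lt (snd r) (snd s)"
  shows "\<exists>h\<in>C. inc (h p) (h q) \<and> inc (h r) (h s)"
proof -
  obtain g a b c d where g: "g \<in> C" and abcd: "zigzag (fst a) (fst b) (fst c) (fst d)"
     "zigzag (snd c) (snd d) (snd a) (snd b)" "inc (g a) (g b)" "inc (g c) (g d)"
    using zigzag_good by blast
  obtain a1 b1 c1 d1 where 1: "lt a1 (fst p)" "lt (fst q) b1" "lt c1 (fst r)" "lt (fst s) d1"
     "zigzag a1 b1 c1 d1"
    using zigzag_around[OF assms(1,3)] .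
  \<comment> \<open>In the second coordinate the pairs exchange roles: \<open>r, s\<close> is the
    comparable one.\<close>
  obtain c2 d2 a2 b2 where 2: "lt c2 (snd r)" "lt (snd s) d2" "lt a2 (snd p)" "lt (snd q) b2"
     "zigzag c2 d2 a2 b2"
    using zigzag_around[OF assms(4,2)] .
  obtain \<alpha> where \<alpha>: "order_aut le \<alpha>" "\<alpha> a1 = fst a" "\<alpha> b1 = fst b" "\<alpha> c1 = fst c" "\<alpha> d1 = fst d"
    using zigzag_aut[OF 1(5) abcd(1)] .
  obtain \<beta> where \<beta>: "order_aut le \<beta>" "\<beta> c2 = snd c" "\<beta> d2 = snd d" "\<beta> a2 = snd a" "\<beta> b2 = snd b"
    using zigzag_aut[OF 2(5) abcd(2)] .
  define h where "h p = g (\<alpha> (fst p), \<beta> (snd p))" for p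
  have h: "h \<in> C" unfolding h_def using aut_mem[OF g \<alpha>(1) \<beta>(1)] .
  have "inc (h (a1, a2)) (h (b1, b2))" "inc (h (c1, c2)) (h (d1, d2))"
    using abcd(3,4) by (simp_all add: h_def \<alpha> \<beta>)
  moreover have "lt (h (a1, a2)) (h p)" "lt (h q) (h (b1, b2))" "lt (h (c1, c2)) (h r)"
      "lt (h s) (h (d1, d2))"
    using 1 2 by (auto intro!: pres_lt[OF h])
  ultimately have "\<not> lt (h p) (h q)" "\<not> lt (h r) (h s)"
    using lt_trans lt_not_inc by blast+
  then show ?thesis using lt_inc_cases[OF h assms(1,2)] inc_lt_cases[OF h assms(3,4)] h by blast
qed

text \<open>Types for which members of \<open>C\<close> leave only < or incomparable open. Other
  failures of the product order, such as type (<, >), are reduced to these by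
  \<open>separable_below\<close>.\<close>

definition separable :: "'a \<times> 'a \<Rightarrow> 'a \<times> 'a \<Rightarrow> bool" where
  "separable p q \<longleftrightarrow> lt (fst p) (fst q) \<and> inc (snd p) (snd q) \<or>
     inc (fst p) (fst q) \<and> lt (snd p) (snd q) \<or> inc (fst p) (fst q) \<and> inc (snd p) (snd q)"

lemma separable_cases: "separable p q \<Longrightarrow> h \<in> C \<Longrightarrow> lt (h p) (h q) \<or> inc (h p) (h q)"
  unfolding separable_def using lt_inc_cases inc_lt_cases pres_inc by blast

text \<open>If \<open>u\<close> splits all pairs but \<open>m\<close> and \<open>v\<close> all but \<open>m'\<close>, then \<open>x \<mapsto> (u x, v x)\<close>
  turns \<open>m, m'\<close> into pairs of types \<open>(<, \<bottom>)\<close> and \<open>(\<bottom>, <)\<close>, and keeps the others split.\<close>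
lemma all_separable_inc:
  assumes "finite K" "\<And>p q. (p, q) \<in> K \<Longrightarrow> separable p q"
  shows "\<exists>h\<in>C. \<forall>(p, q)\<in>K. inc (h p) (h q)"
  using assms
proof (induction K rule: finite_psubset_induct)
  case (psubset K)
  show ?case
  proof (cases "\<exists>p q r s. (p, q) \<in> K \<and> (r, s) \<in> K \<and> (p, q) \<noteq> (r, s)")
    case True
    then obtain p q r s where K: "(p, q) \<in> K" "(r, s) \<in> K" "(p, q) \<noteq> (r, s)" by blast
    \<comment> \<open>Two different proper subsets are used, hence the induction along proper
      inclusion.\<close>
    have "K - {(p, q)} \<subset> K" "K - {(r, s)} \<subset> K" using K by blast+
    then obtain u v where u: "u \<in> C" "\<forall>(x, y)\<in>K - {(p, q)}. inc (u x) (u y)"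
      and v: "v \<in> C" "\<forall>(x, y)\<in>K - {(r, s)}. inc (v x) (v y)"
      using psubset.IH psubset.prems by (metis Diff_iff)
    have "lt (u p) (u q) \<or> inc (u p) (u q)" "lt (v r) (v s) \<or> inc (v r) (v s)"
      using separable_cases psubset.prems K u(1) v(1) by blast+
    then consider "inc (u p) (u q)" | "inc (v r) (v s)" | "lt (u p) (u q)" "lt (v r) (v s)"
      by blast
    then show ?thesis
    proof cases
      case 1
      then show ?thesis using u by blast
    next
      case 2
      then show ?thesis using v by blast
    next
      case 3
      moreover have "inc (v p) (v q)" "inc (u r) (u s)" using u(2) v(2) K by blast+
      ultimately obtain w where w: "w \<in> C"
        "inc (w (u p, v p)) (w (u q, v q))" "inc (w (u r, v r)) (w (u s, v s))"
        using two_pairs_inc[of "(u p, v p)" "(u q, v q)" "(u r, v r)" "(u s, v s)"] by auto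
      have "inc (w (u x, v x)) (w (u y, v y))" if "(x, y) \<in> K" for x y
      proof (cases "(x, y) = (p, q) \<or> (x, y) = (r, s)")
        case False
        then have "inc (u x) (u y)" "inc (v x) (v y)" using u(2) v(2) that by blast+
        then show ?thesis using pres_inc[OF w(1)] by simp
      qed (use w in auto)
      moreover have "(\<lambda>x. w (u x, v x)) \<in> C" using comp w(1) u(1) v(1) .
      ultimately show ?thesis by (intro bexI[of _ "\<lambda>x. w (u x, v x)"]) auto
    qed
  next
    case False
    \<comment> \<open>A single pair is split by the projection to a coordinate in which it is
      incomparable.\<close>
    then obtain p q where "K \<subseteq> {(p, q)}" by (metis insertI1 prod.collapse subsetI)
    moreover have "inc (fst p) (fst q) \<or> inc (snd p) (snd q)" if "(p, q) \<in> K"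
      using psubset.prems[OF that] by (auto simp: separable_def)
    ultimately show ?thesis using fst_mem snd_mem by blast
  qed
qed

section \<open>Reflecting the product order on finite sets\<close>

abbreviation dominated :: "('a \<times> 'a) set \<Rightarrow> ('a \<times> 'a \<Rightarrow> 'a) \<Rightarrow> bool" where
  "dominated A h \<equiv> \<forall>p\<in>A. \<forall>q\<in>A. le (h p) (h q) \<longrightarrow> le (fst p) (fst q) \<and> le (snd p) (snd q)"

lemma dominated_swap: "dominated (prod.swap ` A) h \<Longrightarrow> dominated A (\<lambda>p. h (snd p, fst p))"
  by (simp add: prod.swap_def conj_commute)

text \<open>Each coordinate of \<open>a\<close> is taken below that of \<open>q\<close> if the
  coordinate of \<open>p\<close> is, and incomparable to it otherwise. The second case occurs at
  least once by assumption.\<close>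

lemma separable_below:
  assumes "\<not> (le (fst p) (fst q) \<and> le (snd p) (snd q))"
  shows "\<exists>a. lt (fst a) (fst p) \<and> lt (snd a) (snd p) \<and> separable a q"
proof -
  have "\<exists>x. lt x y \<and> (if le y z then lt x z else inc x z)" for y z
    using below_avoiding[of y z] below_exists[of y] lt_le_trans by metis
  then obtain x x' where
    "lt x (fst p)" "if le (fst p) (fst q) then lt x (fst q) else inc x (fst q)"
    "lt x' (snd p)" "if le (snd p) (snd q) then lt x' (snd q) else inc x' (snd q)"
    by metis
  then show ?thesis using assms
    by (intro exI[of _ "(x, x')"]) (auto simp: separable_def split: if_splits)
qed

text \<open>For a pair \<open>p, q\<close> outside the product order it suffices to split
  \<open>q\<close> from the point \<open>a\<close> of \<open>separable_below\<close>:
  \<open>le (h p) (h q)\<close> would give \<open>h a < h p\<close> and hence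
  \<open>h a < h q\<close>. All these separable pairs are split at once.\<close>

lemma dominated_exists:
  assumes "finite A"
  shows "\<exists>h\<in>C. dominated A h"
proof -
  define B where "B = {(p, q) \<in> A \<times> A. \<not> (le (fst p) (fst q) \<and> le (snd p) (snd q))}"
  have "\<forall>m\<in>B. \<exists>a. lt (fst a) (fst (fst m)) \<and> lt (snd a) (snd (fst m)) \<and> separable a (snd m)"
    using separable_below by (auto simp: B_def)
  then obtain a where a: "\<And>m. m \<in> B \<Longrightarrow> lt (fst (a m)) (fst (fst m)) \<and>
      lt (snd (a m)) (snd (fst m)) \<and> separable (a m) (snd m)"
    by metis
  have "finite B" using assms by (simp add: B_def finite_subset[of _ "A \<times> A"] subset_iff)
  then obtain h where h: "h \<in> C" "\<forall>(p, q)\<in>(\<lambda>m. (a m, snd m)) ` B. inc (h p) (h q)"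
    using all_separable_inc[of "(\<lambda>m. (a m, snd m)) ` B"] a by blast
  have "\<not> le (h p) (h q)" if "(p, q) \<in> B" for p q
  proof
    assume "le (h p) (h q)"
    moreover have "lt (h (a (p, q))) (h p)" using a[OF that] pres_lt[OF h(1)] by simp
    ultimately have "lt (h (a (p, q))) (h q)" using lt_le_trans by blast
    moreover have "inc (h (a (p, q))) (h q)" using h(2) that by force
    ultimately show False using lt_not_inc by blast
  qed
  then have "dominated A h" by (auto simp: B_def)
  then show ?thesis using h(1) by blast
qed

text \<open>If \<open>u\<close> handles the pairs in \<open>M\<close> and \<open>v\<close> one more,
  composing with a \<open>w\<close> that reflects the product order keeps both achievements:
  \<open>le (g x) (g y)\<close> forces \<open>le (u x) (u y)\<close> and
  \<open>le (v x) (v y)\<close>. Swapping coordinates transfers \<open>1\<close> to pairs with equal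
  second entries.\<close>

lemma separate_axis_pairs:
  assumes 1: "\<And>A p q. finite A \<Longrightarrow> fst p = fst q \<Longrightarrow> lt (snd p) (snd q) \<Longrightarrow>
      \<exists>h\<in>C. dominated A h \<and> \<not> le (h p) (h q)"
    and "finite M" "finite A"
    and "\<And>p q. (p, q) \<in> M \<Longrightarrow>
      fst p = fst q \<and> lt (snd p) (snd q) \<or> snd p = snd q \<and> lt (fst p) (fst q)"
  shows "\<exists>h\<in>C. dominated A h \<and> (\<forall>(p, q)\<in>M. \<not> le (h p) (h q))"
proof -
  have 2: "\<exists>h\<in>C. dominated A h \<and> \<not> le (h p) (h q)"
    if "finite A" "snd p = snd q" "lt (fst p) (fst q)" for A p q
  proof -
    have "finite (prod.swap ` A)" "fst (prod.swap p) = fst (prod.swap q)"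
        "lt (snd (prod.swap p)) (snd (prod.swap q))"
      using that by simp_all
    from 1[OF this] obtain h where h: "h \<in> C" "dominated (prod.swap ` A) h"
        "\<not> le (h (prod.swap p)) (h (prod.swap q))"
      by blast
    define g where "g p = h (snd p, fst p)" for p
    have "dominated A g" unfolding g_def using dominated_swap[OF h(2)] .
    moreover have "\<not> le (g p) (g q)" using h(3) by (simp add: g_def prod.swap_def)
    moreover have "g \<in> C" unfolding g_def using swap_mem[OF h(1)] .
    ultimately show ?thesis by blast
  qed
  show ?thesis
    using assms(2-)
  proof (induction M rule: finite_induct)
    case empty
    then show ?case using dominated_exists by simp
  next
    case (insert m M)
    obtain p q where m: "m = (p, q)" by (cases m)
    have "fst x = fst y \<and> lt (snd x) (snd y) \<or> snd x = snd y \<and> lt (fst x) (fst y)"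
      if "(x, y) \<in> M" for x y
      using insert.prems(2) that by blast
    from insert.IH[OF insert.prems(1) this] obtain u where
      u: "u \<in> C" "dominated A u" "\<forall>(p, q)\<in>M. \<not> le (u p) (u q)" by blast
    have "fst p = fst q \<and> lt (snd p) (snd q) \<or> snd p = snd q \<and> lt (fst p) (fst q)"
      using insert.prems(2) m by blast
    then obtain v where v: "v \<in> C" "dominated A v" "\<not> le (v p) (v q)"
      using 1[OF insert.prems(1), of p q] 2[OF insert.prems(1), of p q] by blast
    \<comment> \<open>The pairs to be separated need not lie in \<open>A\<close>, so
      \<open>w\<close> must reflect the order on the images of their endpoints as well.\<close>
    define S where "S = A \<union> fst ` insert m M \<union> snd ` insert m M"
    have "finite ((\<lambda>x. (u x, v x)) ` S)" using insert by (simp add: S_def)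
    then obtain w where w: "w \<in> C" "dominated ((\<lambda>x. (u x, v x)) ` S) w"
      using dominated_exists by blast
    have *: "le (u x) (u y) \<and> le (v x) (v y)"
      if "x \<in> S" "y \<in> S" "le (w (u x, v x)) (w (u y, v y))" for x y
      using w(2)[rule_format, OF imageI imageI, OF that(1,2)] that(3) by simp
    define g where "g x = w (u x, v x)" for x
    have "dominated A g"
      using * u(2) unfolding g_def S_def by blast
    moreover have "\<not> le (g x) (g y)" if "(x, y) \<in> insert m M" for x y
    proof
      assume "le (g x) (g y)"
      moreover have "x \<in> S" "y \<in> S" using that by (force simp: S_def)+
      ultimately have "le (u x) (u y)" "le (v x) (v y)" unfolding g_def using * by blast+
      then show False using that m u(3) v(3) by blast
    qed
    moreover have "g \<in> C" unfolding g_def using comp[OF w(1) u(1) v(1)] .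
    ultimately show ?case by blast
  qed
qed

text \<open>When \<open>h\<close> reflects the product order on \<open>A\<close>,
  \<open>le (h p) (h q)\<close> is possible only for \<open>p = q\<close>, for type (<, <), and for
  the pairs in \<open>M\<close>. The first two are forced, and the last are removed by
  \<open>separate_axis_pairs\<close>.\<close>

lemma strict_embedding:
  assumes 1: "\<And>A p q. finite A \<Longrightarrow> fst p = fst q \<Longrightarrow> lt (snd p) (snd q) \<Longrightarrow>
      \<exists>h\<in>C. dominated A h \<and> \<not> le (h p) (h q)"
    and A: "finite A"
  shows "\<exists>h\<in>C. \<forall>p\<in>A. \<forall>q\<in>A. le (h p) (h q) \<longleftrightarrow>
      p = q \<or> lt (fst p) (fst q) \<and> lt (snd p) (snd q)"
proof -
  define M where "M = {(p, q) \<in> A \<times> A. fst p = fst q \<and> lt (snd p) (snd q) \<or>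
     snd p = snd q \<and> lt (fst p) (fst q)}"
  have "finite M" using A by (simp add: M_def finite_subset[of _ "A \<times> A"] subset_iff)
  moreover have "fst p = fst q \<and> lt (snd p) (snd q) \<or> snd p = snd q \<and> lt (fst p) (fst q)"
    if "(p, q) \<in> M" for p q using that by (simp add: M_def)
  ultimately have "\<exists>h\<in>C. dominated A h \<and> (\<forall>(p, q)\<in>M. \<not> le (h p) (h q))"
    by (intro separate_axis_pairs[OF 1 _ A])
  then obtain h where
    h: "h \<in> C" "dominated A h" "\<forall>(p, q)\<in>M. \<not> le (h p) (h q)"
    by blast
  have "p = q \<or> lt (fst p) (fst q) \<and> lt (snd p) (snd q)"
    if "p \<in> A" "q \<in> A" "le (h p) (h q)" for p q
  proof -
    have "(p, q) \<notin> M" using that(3) h(3) by blast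
    moreover have "le (fst p) (fst q)" "le (snd p) (snd q)" using that h(2) by blast+
    ultimately show ?thesis using that(1,2) by (auto simp: M_def lt_of_def prod_eq_iff)
  qed
  moreover have "le (h p) (h q)" if "p = q \<or> lt (fst p) (fst q) \<and> lt (snd p) (snd q)" for p q
    using that pres_lt[OF h(1), of p q, THEN lt_imp_le] by (elim disjE conjE) simp_all
  ultimately show ?thesis using h(1) by blast
qed

text \<open>\<open>A0\<close> is a finite set on which domination forces
  \<open>le (h p0) (h q0)\<close>. Independent automorphisms of the coordinates carry
  \<open>p0, q0\<close> to any pair of type (=, <), and the image of \<open>A0\<close> does the same
  for that pair. Swapping covers (<, =), and the remaining types need no forcing set.\<close>

lemma weak_embedding_bound:
  assumes A0: "finite A0" "fst p0 = fst q0" "lt (snd p0) (snd q0)"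
      "\<And>h. h \<in> C \<Longrightarrow> dominated A0 h \<Longrightarrow> le (h p0) (h q0)"
    and pq: "le (fst p) (fst q)" "le (snd p) (snd q)"
  shows "\<exists>B. finite B \<and> (\<forall>h\<in>C. dominated B h \<longrightarrow> le (h p) (h q))"
proof -
  have fst_eq: "\<exists>B. finite B \<and> (\<forall>h\<in>C. dominated B h \<longrightarrow> le (h p) (h q))"
    if "fst p = fst q" "lt (snd p) (snd q)" for p q
  proof -
    obtain \<alpha> where \<alpha>: "order_aut le \<alpha>" "\<alpha> (fst p0) = fst p"
      using point_aut .
    obtain \<beta> where \<beta>: "order_aut le \<beta>" "\<beta> (snd p0) = snd p" "\<beta> (snd q0) = snd q"
      using lt_aut[OF A0(3) \<open>lt (snd p) (snd q)\<close>] .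
    let ?\<phi> = "\<lambda>x. (\<alpha> (fst x), \<beta> (snd x))"
    have "le (h p) (h q)" if h: "h \<in> C" "dominated (?\<phi> ` A0) h" for h
    proof -
      have "dominated A0 (\<lambda>x. h (?\<phi> x))"
        using h(2) by (simp add: order_aut_le[OF \<alpha>(1)] order_aut_le[OF \<beta>(1)])
      then have "le (h (?\<phi> p0)) (h (?\<phi> q0))" using A0(4)[OF aut_mem[OF h(1) \<alpha>(1) \<beta>(1)]] by simp
      moreover have "?\<phi> p0 = p" "?\<phi> q0 = q"
        using \<alpha>(2) \<beta>(2,3) A0(2) \<open>fst p = fst q\<close> by (simp_all add: prod_eq_iff)
      ultimately show ?thesis by simp
    qed
    moreover have "finite (?\<phi> ` A0)" using A0(1) by simp
    ultimately show ?thesis by blast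
  qed
  have snd_eq: "\<exists>B. finite B \<and> (\<forall>h\<in>C. dominated B h \<longrightarrow> le (h p) (h q))"
    if "snd p = snd q" "lt (fst p) (fst q)" for p q
  proof -
    have "fst (prod.swap p) = fst (prod.swap q)" "lt (snd (prod.swap p)) (snd (prod.swap q))"
      using that by simp_all
    from fst_eq[OF this] obtain B where B: "finite B"
        "\<And>h. h \<in> C \<Longrightarrow> dominated B h \<Longrightarrow> le (h (prod.swap p)) (h (prod.swap q))"
      by blast
    have "le (h p) (h q)" if h: "h \<in> C" "dominated (prod.swap ` B) h" for h
    proof -
      from B(2)[OF swap_mem[OF h(1)] dominated_swap[OF h(2)]] show ?thesis by simp
    qed
    moreover have "finite (prod.swap ` B)" using B(1) by simp
    ultimately show ?thesis by blast
  qed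
  consider "p = q" | "fst p = fst q" "lt (snd p) (snd q)" | "snd p = snd q" "lt (fst p) (fst q)"
    | "lt (fst p) (fst q)" "lt (snd p) (snd q)"
    using pq by (auto simp: lt_of_def prod_eq_iff)
  then show ?thesis
  proof cases
    case 1
    then show ?thesis by (intro exI[of _ "{}"]) simp
  next
    case 2
    then show ?thesis by (rule fst_eq)
  next
    case 3
    then show ?thesis by (rule snd_eq)
  next
    case 4
    then show ?thesis using pres_lt lt_imp_le by (intro exI[of _ "{}"]) simp
  qed
qed

text \<open>One \<open>h\<close> that reflects the product order on \<open>A\<close> and on the
  forcing sets of all finitely many comparable pairs in \<open>A\<close> has both
  directions.\<close>

lemma weak_embedding:
  assumes A0: "finite A0" "fst p0 = fst q0" "lt (snd p0) (snd q0)"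
      "\<And>h. h \<in> C \<Longrightarrow> dominated A0 h \<Longrightarrow> le (h p0) (h q0)"
    and A: "finite A"
  shows "\<exists>h\<in>C. \<forall>p\<in>A. \<forall>q\<in>A. le (h p) (h q) \<longleftrightarrow> le (fst p) (fst q) \<and> le (snd p) (snd q)"
proof -
  define B where "B p q = (SOME B. finite B \<and> (\<forall>h\<in>C. dominated B h \<longrightarrow> le (h p) (h q)))" for p q
  have B: "finite (B p q) \<and> (\<forall>h\<in>C. dominated (B p q) h \<longrightarrow> le (h p) (h q))"
    if "le (fst p) (fst q)" "le (snd p) (snd q)" for p q
    unfolding B_def using weak_embedding_bound[OF A0 that] by (rule someI_ex)
  define M where "M = {(p, q) \<in> A \<times> A. le (fst p) (fst q) \<and> le (snd p) (snd q)}"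
  have "finite M" using A by (simp add: M_def finite_subset[of _ "A \<times> A"] subset_iff)
  then have "finite (\<Union>(p, q)\<in>M. B p q)"
    by (rule finite_UN_I) (use B in \<open>auto simp: M_def\<close>)
  then have "finite (A \<union> (\<Union>(p, q)\<in>M. B p q))" using A by simp
  then obtain h where h: "h \<in> C" "dominated (A \<union> (\<Union>(p, q)\<in>M. B p q)) h"
    using dominated_exists by blast
  have "le (h p) (h q)" if "(p, q) \<in> M" for p q
  proof -
    have "B p q \<subseteq> A \<union> (\<Union>(p, q)\<in>M. B p q)" using that by auto
    then have "dominated (B p q) h" using h(2) by blast
    moreover have "le (fst p) (fst q)" "le (snd p) (snd q)" using that by (simp_all add: M_def)
    ultimately show ?thesis using B h(1) by blast
  qed
  moreover have "dominated A h" using h(2) by blast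
  ultimately have "le (h p) (h q) \<longleftrightarrow> le (fst p) (fst q) \<and> le (snd p) (snd q)"
    if "p \<in> A" "q \<in> A" for p q
    using that unfolding M_def by blast
  then show ?thesis using h(1) by blast
qed

text \<open>Either every finite set leaves room to separate a pair of type (=, <), or a single
  finite obstruction exists, which homogeneity spreads to all such pairs.\<close>

lemma local_embedding:
  "(\<forall>A. finite A \<longrightarrow> (\<exists>h\<in>C. \<forall>p\<in>A. \<forall>q\<in>A. le (h p) (h q) \<longleftrightarrow>
       p = q \<or> lt (fst p) (fst q) \<and> lt (snd p) (snd q))) \<or>
   (\<forall>A. finite A \<longrightarrow> (\<exists>h\<in>C. \<forall>p\<in>A. \<forall>q\<in>A. le (h p) (h q) \<longleftrightarrow>
       le (fst p) (fst q) \<and> le (snd p) (snd q)))"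
proof (cases "\<forall>A p q. finite A \<longrightarrow> fst p = fst q \<longrightarrow> lt (snd p) (snd q) \<longrightarrow>
    (\<exists>h\<in>C. dominated A h \<and> \<not> le (h p) (h q))")
  case True
  then show ?thesis by (intro disjI1 allI impI strict_embedding) blast+
next
  case False
  then obtain A0 p0 q0 where "finite A0" "fst p0 = fst q0" "lt (snd p0) (snd q0)"
      "\<And>h. h \<in> C \<Longrightarrow> dominated A0 h \<Longrightarrow> le (h p0) (h q0)" by blast
  from weak_embedding[OF this] show ?thesis by blast
qed

end

subsection \<open>Compactness\<close>

context random_order
begin

text \<open>The values at one more index fall into finitely many types over the finitely many
  values already fixed, and one representative per type suffices because constraints are
  invariant under automorphisms.\<close>
lemma extend_finitely_satisfiable:
  fixes K :: "(('i \<Rightarrow> 'a) \<Rightarrow> bool) set"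
  assumes inv: "\<And>k g \<alpha>. k \<in> K \<Longrightarrow> order_aut le \<alpha> \<Longrightarrow> k g \<Longrightarrow> k (\<lambda>i. \<alpha> (g i))"
    and "finite F"
    and g: "\<And>\<Theta>. finite \<Theta> \<Longrightarrow> \<Theta> \<subseteq> K \<Longrightarrow> \<exists>g'. (\<forall>j\<in>F. g' j = g j) \<and> (\<forall>k\<in>\<Theta>. k g')"
  shows "\<exists>v. \<forall>\<Theta>. finite \<Theta> \<longrightarrow> \<Theta> \<subseteq> K \<longrightarrow>
    (\<exists>g'. (\<forall>j\<in>F. g' j = g j) \<and> g' i = v \<and> (\<forall>k\<in>\<Theta>. k g'))"
proof (rule ccontr)
  assume "\<not> ?thesis"
  then have "\<forall>v. \<exists>\<Theta>. finite \<Theta> \<and> \<Theta> \<subseteq> K \<and>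
      \<not> (\<exists>g'. (\<forall>j\<in>F. g' j = g j) \<and> g' i = v \<and> (\<forall>k\<in>\<Theta>. k g'))"
    by (simp only: not_ex not_all not_imp simp_thms)
  from choice[OF this] obtain T where *: "\<forall>v. finite (T v) \<and> T v \<subseteq> K \<and>
      \<not> (\<exists>g'. (\<forall>j\<in>F. g' j = g j) \<and> g' i = v \<and> (\<forall>k\<in>T v. k g'))"
    by (elim exE)
  have T: "finite (T v)" "T v \<subseteq> K"
      "\<not> (\<exists>g'. (\<forall>j\<in>F. g' j = g j) \<and> g' i = v \<and> (\<forall>k\<in>T v. k g'))" for v
    using * by blast+
  define ty where "ty v = ({j \<in> F. le (g j) v}, {j \<in> F. le v (g j)})" for v
  have "range ty \<subseteq> Pow F \<times> Pow F" by (auto simp: ty_def)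
  then have "finite (range ty)" using \<open>finite F\<close> by (simp add: finite_subset)
  then have "finite (\<Union>t\<in>range ty. T (inv ty t))" using T(1) by blast
  moreover have "(\<Union>t\<in>range ty. T (inv ty t)) \<subseteq> K" using T(2) by blast
  ultimately have "\<exists>g'. (\<forall>j\<in>F. g' j = g j) \<and> (\<forall>k\<in>(\<Union>t\<in>range ty. T (inv ty t)). k g')"
    by (rule g)
  then obtain g' where g': "\<forall>j\<in>F. g' j = g j" "\<forall>k\<in>(\<Union>t\<in>range ty. T (inv ty t)). k g'"
    by (elim exE conjE)
  define v where "v = inv ty (ty (g' i))"
  have "ty v = ty (g' i)" unfolding v_def by (rule f_inv_into_f) simp
  then have sets: "{j \<in> F. le (g j) (g' i)} = {j \<in> F. le (g j) v}"
      "{j \<in> F. le (g' i) (g j)} = {j \<in> F. le v (g j)}"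
    by (simp_all add: ty_def)
  have type: "le (g j) (g' i) \<longleftrightarrow> le (g j) v" "le (g' i) (g j) \<longleftrightarrow> le v (g j)" if "j \<in> F" for j
    using sets[THEN equalityD1] sets[THEN equalityD2] that by blast+
  define \<rho> where "\<rho> = insert (g' i, v) ((\<lambda>j. (g j, g j)) ` F)"
  have "le x y \<longleftrightarrow> le x' y'" if xy: "(x, x') \<in> \<rho>" "(y, y') \<in> \<rho>" for x x' y y'
  proof -
    have "x = g' i \<and> x' = v \<or> (\<exists>j\<in>F. x = g j \<and> x' = g j)"
         "y = g' i \<and> y' = v \<or> (\<exists>j\<in>F. y = g j \<and> y' = g j)"
      using xy by (auto simp: \<rho>_def)
    then show ?thesis using type by (elim disjE bexE conjE) simp_all
  qed
  moreover have "finite \<rho>" using \<open>finite F\<close> by (simp add: \<rho>_def)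
  ultimately obtain \<alpha> where \<alpha>: "order_aut le \<alpha>" "\<And>x x'. (x, x') \<in> \<rho> \<Longrightarrow> \<alpha> x = x'"
    using finite_iso_extends[of \<rho>] by blast
  have "\<alpha> (g' i) = v" using \<alpha>(2) by (simp add: \<rho>_def)
  moreover have "\<forall>j\<in>F. \<alpha> (g' j) = g j" using \<alpha>(2) g'(1) by (simp add: \<rho>_def)
  moreover have "k (\<lambda>i. \<alpha> (g' i))" if "k \<in> T v" for k
  proof -
    have "k g'" using g'(2) that unfolding v_def by blast
    then show ?thesis using inv \<alpha>(1) T(2) that by blast
  qed
  ultimately have "\<exists>h. (\<forall>j\<in>F. h j = g j) \<and> h i = v \<and> (\<forall>k\<in>T v. k h)"
    by (intro exI[of _ "\<lambda>i. \<alpha> (g' i)"] conjI ballI) simp_all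
  with T(3)[of v] show False by (rule notE)
qed

text \<open>Values are fixed along an enumeration of the indices while every finite set of
  constraints stays satisfiable. Each constraint has finite support, so the limit agrees there with
  a solution of that constraint.\<close>

lemma compactness:
  fixes K :: "(('i \<Rightarrow> 'a) \<Rightarrow> bool) set"
  assumes "countable (UNIV :: 'i set)"
    and inv: "\<And>k g \<alpha>. k \<in> K \<Longrightarrow> order_aut le \<alpha> \<Longrightarrow> k g \<Longrightarrow> k (\<lambda>i. \<alpha> (g i))"
    and supp: "\<And>k. k \<in> K \<Longrightarrow> \<exists>F. finite F \<and> (\<forall>g g'. (\<forall>i\<in>F. g i = g' i) \<longrightarrow> k g \<longrightarrow> k g')"
    and sat: "\<And>\<Theta>. finite \<Theta> \<Longrightarrow> \<Theta> \<subseteq> K \<Longrightarrow> \<exists>g. \<forall>k\<in>\<Theta>. k g"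
  shows "\<exists>g. \<forall>k\<in>K. k g"
proof -
  define e :: "nat \<Rightarrow> 'i" where "e = from_nat_into UNIV"
  have "range e = UNIV" unfolding e_def using assms(1) by (simp add: range_from_nat_into)
  then have e: "\<exists>n. e n = i" for i by (metis rangeE UNIV_I)
  \<comment> \<open>Only the values of \<open>g\<close> at the first \<open>n\<close> indices matter
    here.\<close>
  define good where "good n g \<longleftrightarrow> (\<forall>\<Theta>. finite \<Theta> \<longrightarrow> \<Theta> \<subseteq> K \<longrightarrow>
    (\<exists>g'. (\<forall>m<n. g' (e m) = g (e m)) \<and> (\<forall>k\<in>\<Theta>. k g')))" for n :: nat and g
  have "\<exists>G. \<forall>n. good n (G n) \<and> (\<forall>m<n. G (Suc n) (e m) = G n (e m))"
  proof (rule dependent_nat_choice)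
    show "\<exists>g. good 0 g" using sat by (auto simp: good_def)
  next
    fix g n assume g: "good n g"
    have image: "(\<forall>j\<in>e ` {..<n}. P j) \<longleftrightarrow> (\<forall>m<n. P (e m))" for P by auto
    have *: "\<exists>g'. (\<forall>j\<in>e ` {..<n}. g' j = g j) \<and> (\<forall>k\<in>\<Theta>. k g')"
      if "finite \<Theta>" "\<Theta> \<subseteq> K" for \<Theta> using g that unfolding good_def image by simp
    have "\<exists>v. \<forall>\<Theta>. finite \<Theta> \<longrightarrow> \<Theta> \<subseteq> K \<longrightarrow>
        (\<exists>g'. (\<forall>j\<in>e ` {..<n}. g' j = g j) \<and> g' (e n) = v \<and> (\<forall>k\<in>\<Theta>. k g'))"
      by (rule extend_finitely_satisfiable) (fact inv, simp, fact *)
    then obtain v where v: "\<forall>\<Theta>. finite \<Theta> \<longrightarrow> \<Theta> \<subseteq> K \<longrightarrow>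
        (\<exists>g'. (\<forall>j\<in>e ` {..<n}. g' j = g j) \<and> g' (e n) = v \<and> (\<forall>k\<in>\<Theta>. k g'))"
      by (elim exE)
    \<comment> \<open>Injectivity of \<open>e\<close> is not assumed; an index that already has a
      value keeps it.\<close>
    define h where "h = (if e n \<in> e ` {..<n} then g else g(e n := v))"
    have h: "\<forall>m<n. h (e m) = g (e m)"
      unfolding h_def by (auto, metis imageI lessThan_iff)
    have "good (Suc n) h"
      unfolding good_def
    proof (intro allI impI)
      fix \<Theta> assume "finite \<Theta>" "\<Theta> \<subseteq> K"
      with v obtain g' where g': "\<forall>j\<in>e ` {..<n}. g' j = g j" "g' (e n) = v" "\<forall>k\<in>\<Theta>. k g'"
        by blast
      have "g' (e n) = h (e n)" using g'(1,2) by (cases "e n \<in> e ` {..<n}")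
          (simp_all only: h_def fun_upd_same if_True if_False)
      then have "\<forall>m<Suc n. g' (e m) = h (e m)" using g'(1) h by (simp add: less_Suc_eq)
      then show "\<exists>g'. (\<forall>m<Suc n. g' (e m) = h (e m)) \<and> (\<forall>k\<in>\<Theta>. k g')" using g'(3) by blast
    qed
    then show "\<exists>g'. good (Suc n) g' \<and> (\<forall>m<n. g' (e m) = g (e m))" using h by blast
  qed
  then obtain G where G: "\<And>n. good n (G n)" "\<And>n m. m < n \<Longrightarrow> G (Suc n) (e m) = G n (e m)"
    by blast
  have stable: "G n (e m) = G (Suc m) (e m)" if "m < n" for n m
    using that by (induction n) (auto simp: less_Suc_eq G(2))
  define idx where "idx i = (SOME n. e n = i)" for i
  have idx: "e (idx i) = i" for i unfolding idx_def using e by (rule someI_ex)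
  \<comment> \<open>Stage \<open>Suc m\<close> is the first to fix the value at \<open>e m\<close>,
    and later stages keep it.\<close>
  define g where "g i = G (Suc (idx i)) i" for i
  have "k g" if k: "k \<in> K" for k
  proof -
    obtain F where F: "finite F" "\<And>g g'. (\<forall>i\<in>F. g i = g' i) \<Longrightarrow> k g \<Longrightarrow> k g'"
      using supp[OF k] by blast
    obtain N where N: "\<forall>m\<in>idx ` F. m < N"
      using F(1) finite_nat_set_iff_bounded by blast
    have "finite {k}" "{k} \<subseteq> K" using k by simp_all
    with G(1)[of N, unfolded good_def]
    have "\<exists>g'. (\<forall>m<N. g' (e m) = G N (e m)) \<and> (\<forall>k\<in>{k}. k g')" by (elim allE impE)
    then obtain g' where g': "\<forall>m<N. g' (e m) = G N (e m)" "k g'" by auto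
    have "g' i = g i" if "i \<in> F" for i
    proof -
      have "idx i < N" using N that by blast
      then have "g' (e (idx i)) = G (Suc (idx i)) (e (idx i))"
        using g'(1)[rule_format] stable[of "idx i" N] by (simp only:)
      then show ?thesis by (simp add: idx g_def)
    qed
    then show ?thesis using F(2) g'(2) by blast
  qed
  then show ?thesis by blast
qed

end

subsection \<open>Polymorphisms and primitive positive definability\<close>

lemma fo_sat_aut:
  assumes "order_aut le h"
  shows "fo_sat le \<phi> (\<lambda>i. h (s i)) \<longleftrightarrow> fo_sat le \<phi> s"
proof (induction \<phi> arbitrary: s)
  case (FEq i j)
  then show ?case using assms by (simp add: order_aut_def bij_def inj_eq)
next
  case (FEx v \<phi>)
  have "(\<lambda>i. h (s i))(v := h a) = (\<lambda>i. h ((s(v := a)) i))" for a by auto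
  then have "fo_sat le \<phi> ((\<lambda>i. h (s i))(v := h a)) \<longleftrightarrow> fo_sat le \<phi> (s(v := a))" for a
    using FEx by metis
  moreover have "\<exists>b. a = h b" for a using assms by (metis bij_pointE order_aut_def)
  ultimately show ?case by (metis fo_sat.simps(5))
qed (use assms in \<open>simp_all add: order_aut_def\<close>)

lemma fo_sat_cong:
  "(\<And>i. i \<in> fo_fv \<phi> \<Longrightarrow> s i = s' i) \<Longrightarrow> fo_sat le \<phi> s \<longleftrightarrow> fo_sat le \<phi> s'"
proof (induction \<phi> arbitrary: s s')
  case (FEx v \<phi>)
  have "fo_sat le \<phi> (s(v := a)) \<longleftrightarrow> fo_sat le \<phi> (s'(v := a))" for a
    by (rule FEx.IH) (use FEx.prems in auto)
  then show ?case by simp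
next
  case (FConj \<phi> \<psi>)
  have "fo_sat le \<phi> s \<longleftrightarrow> fo_sat le \<phi> s'" "fo_sat le \<psi> s \<longleftrightarrow> fo_sat le \<psi> s'"
    by (rule FConj.IH; use FConj.prems in simp)+
  then show ?case by simp
next
  case (FNeg \<phi>)
  have "fo_sat le \<phi> s \<longleftrightarrow> fo_sat le \<phi> s'" by (rule FNeg.IH) (use FNeg.prems in simp)
  then show ?case by simp
qed simp_all

lemma fo_definable_aut:
  assumes "fo_definable le n R" "order_aut le h" "xs \<in> R"
  shows "map h xs \<in> R"
proof -
  obtain \<phi> where \<phi>: "fo_fv \<phi> \<subseteq> {..<n}"
      "R = {xs. length xs = n \<and> fo_sat le \<phi> (\<lambda>i. xs ! i)}"
    using assms(1) unfolding fo_definable_def by blast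
  have xs: "length xs = n" "fo_sat le \<phi> (\<lambda>i. xs ! i)" using assms(3) \<phi>(2) by simp_all
  have "fo_sat le \<phi> (\<lambda>i. map h xs ! i) \<longleftrightarrow> fo_sat le \<phi> (\<lambda>i. h (xs ! i))"
    by (rule fo_sat_cong) (use \<phi>(1) xs(1) in auto)
  then show ?thesis using xs \<phi>(2) fo_sat_aut[OF assms(2)] by simp
qed

text \<open>The binary part of \<open>Pol\<close>, uncurried, so that the columns of two tuples form
  a \<open>zip\<close>. As \<open>zip\<close> truncates, the agreement with \<open>Pol\<close> in
  \<open>binop_in_Pol_iff\<close> uses that all tuples of a relation have the length of its
  arity.\<close>

definition Pol2 :: "'a rstruct \<Rightarrow> ('a \<times> 'a \<Rightarrow> 'a) set" where
  "Pol2 \<Gamma> = {g. \<forall>(n, R)\<in>\<Gamma>. \<forall>s\<in>R. \<forall>t\<in>R. map g (zip s t) \<in> R}"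

lemma Pol2I:
  assumes "\<And>n R s t. (n, R) \<in> \<Gamma> \<Longrightarrow> s \<in> R \<Longrightarrow> t \<in> R \<Longrightarrow> map g (zip s t) \<in> R"
  shows "g \<in> Pol2 \<Gamma>"
  unfolding Pol2_def mem_Collect_eq split_beta using assms by (intro ballI) (metis prod.collapse)

lemma Pol2D: "g \<in> Pol2 \<Gamma> \<Longrightarrow> (n, R) \<in> \<Gamma> \<Longrightarrow> s \<in> R \<Longrightarrow> t \<in> R \<Longrightarrow> map g (zip s t) \<in> R"
  unfolding Pol2_def by fast

lemma binop_in_Pol_iff:
  assumes len: "\<And>n R t. (n, R) \<in> \<Gamma> \<Longrightarrow> t \<in> R \<Longrightarrow> length t = n"
  shows "binop e \<in> Pol \<Gamma> \<longleftrightarrow> (\<lambda>p. e (fst p) (snd p)) \<in> Pol2 \<Gamma>"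
proof -
  let ?f = "\<lambda>xs. e (xs ! 0) (xs ! 1)"
  let ?g = "\<lambda>p. e (fst p) (snd p)"
  have zip: "map (\<lambda>i. ?f (map (\<lambda>t. t ! i) [s, t])) [0..<n] = map ?g (zip s t)"
    if "(n, R) \<in> \<Gamma>" "s \<in> R" "t \<in> R" for n R s t
    using len[OF that(1,2)] len[OF that(1,3)] by (intro nth_equalityI) simp_all
  show ?thesis
  proof
    assume "binop e \<in> Pol \<Gamma>"
    then have *: "\<forall>(n, R)\<in>\<Gamma>. \<forall>ts. length ts = 2 \<and> set ts \<subseteq> R \<longrightarrow>
        map (\<lambda>i. ?f (map (\<lambda>t. t ! i) ts)) [0..<n] \<in> R"
      by (simp only: binop_def Pol_def mem_Collect_eq prod.case)
    show "?g \<in> Pol2 \<Gamma>"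
    proof (rule Pol2I)
      fix n R s t assume st: "(n, R) \<in> \<Gamma>" "s \<in> R" "t \<in> R"
      have "length [s, t] = 2 \<and> set [s, t] \<subseteq> R" using st by simp
      then have "map (\<lambda>i. ?f (map (\<lambda>t. t ! i) [s, t])) [0..<n] \<in> R" using * st(1) by fast
      then show "map ?g (zip s t) \<in> R" by (simp only: zip[OF st])
    qed
  next
    assume g: "?g \<in> Pol2 \<Gamma>"
    have "map (\<lambda>i. ?f (map (\<lambda>t. t ! i) ts)) [0..<n] \<in> R"
      if "(n, R) \<in> \<Gamma>" and len2: "length ts = 2" and "set ts \<subseteq> R" for n R ts
    proof -
      obtain s t where ts: "ts = [s, t]"
        using len2 by (auto simp: numeral_2_eq_2 length_Suc_conv)
      then have st: "(n, R) \<in> \<Gamma>" "s \<in> R" "t \<in> R" using that by simp_all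
      show ?thesis unfolding ts zip[OF st] by (rule Pol2D[OF g st])
    qed
    then have "\<forall>(n, R)\<in>\<Gamma>. \<forall>ts. length ts = 2 \<and> set ts \<subseteq> R \<longrightarrow>
        map (\<lambda>i. ?f (map (\<lambda>t. t ! i) ts)) [0..<n] \<in> R" by fast
    then show "binop e \<in> Pol \<Gamma>"
      by (simp only: binop_def Pol_def mem_Collect_eq prod.case)
  qed
qed

text \<open>Applying \<open>g\<close> to the existential witnesses of \<open>s\<close> and
  \<open>t\<close> gives witnesses for the image tuple.\<close>

lemma Pol2_preserves_pp:
  assumes g: "g \<in> Pol2 \<Gamma>" and pp: "pp_definable \<Gamma> m S" and st: "s \<in> S" "t \<in> S"
  shows "map g (zip s t) \<in> S"
proof -
  obtain k atoms where wf: "\<forall>a\<in>set atoms. pp_atom_wf \<Gamma> (m + k) a"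
    and S: "S = {xs. length xs = m \<and>
      (\<exists>ys. length ys = k \<and> (\<forall>a\<in>set atoms. pp_atom_holds a (xs @ ys)))}"
    using pp unfolding pp_definable_def by blast
  obtain ys where s: "length s = m" "length ys = k" "\<forall>a\<in>set atoms. pp_atom_holds a (s @ ys)"
    using st(1) S by blast
  obtain zs where t: "length t = m" "length zs = k" "\<forall>a\<in>set atoms. pp_atom_holds a (t @ zs)"
    using st(2) S by blast
  let ?w = "map g (zip s t) @ map g (zip ys zs)"
  have w: "?w ! v = g ((s @ ys) ! v, (t @ zs) ! v)" if "v < m + k" for v
    using that s(1,2) t(1,2) by (simp add: nth_append)
  have "pp_atom_holds a ?w" if "a \<in> set atoms" for a
  proof (cases a)
    case (PEq i j)
    then have "i < m + k" "j < m + k" "(s @ ys) ! i = (s @ ys) ! j" "(t @ zs) ! i = (t @ zs) ! j"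
      using wf s(3) t(3) that by force+
    then show ?thesis using PEq w by simp
  next
    case (PRel nR vs)
    obtain n R where nR: "nR = (n, R)" by (cases nR)
    have R: "(n, R) \<in> \<Gamma>" "\<forall>v\<in>set vs. v < m + k"
        "map (\<lambda>v. (s @ ys) ! v) vs \<in> R" "map (\<lambda>v. (t @ zs) ! v) vs \<in> R"
      using wf s(3) t(3) that unfolding PRel nR by force+
    have "map g (zip (map (\<lambda>v. (s @ ys) ! v) vs) (map (\<lambda>v. (t @ zs) ! v) vs)) \<in> R"
      using Pol2D[OF g R(1,3,4)] .
    moreover have "map g (zip (map (\<lambda>v. (s @ ys) ! v) vs) (map (\<lambda>v. (t @ zs) ! v) vs)) =
        map (\<lambda>v. ?w ! v) vs"
      using R(2) w by (simp add: zip_map_map zip_same_conv_map)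
    ultimately show ?thesis by (simp add: PRel nR)
  qed
  then show ?thesis using s(1,2) t(1,2) unfolding S
    by (intro CollectI conjI exI[of _ "map g (zip ys zs)"]) simp_all
qed

text \<open>\<open>X\<close> constrains an unknown \<open>g\<close> at finitely many points only.
  Quantifying existentially over its values there turns the constraints into a conjunction of
  atoms.\<close>

lemma pp_definable_finite_instance:
  assumes "finite X" "\<And>n R ps. (n, R, ps) \<in> X \<Longrightarrow> (n, R) \<in> \<Gamma> \<and> length ps = n"
  shows "pp_definable \<Gamma> (length qs) {map g qs | g. \<forall>(n, R, ps)\<in>X. map g ps \<in> R}"
proof -
  let ?m = "length qs"
  have "finite (set qs \<union> (\<Union>(n, R, ps)\<in>X. set ps))" using assms(1) by auto
  from finite_list[OF this] obtain L where L: "set L = set qs \<union> (\<Union>(n, R, ps)\<in>X. set ps)"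
    by (elim exE)
  obtain Xs where Xs: "set Xs = X" using assms(1) finite_list by blast
  define idx where "idx p = (SOME i. i < length L \<and> L ! i = p)" for p
  have idx: "idx p < length L" "L ! idx p = p" if "p \<in> set L" for p
    using that someI_ex[of "\<lambda>i. i < length L \<and> L ! i = p"]
    by (simp_all add: idx_def in_set_conv_nth)
  have qsL: "q \<in> set L" if "q \<in> set qs" for q using that L by blast
  have psL: "p \<in> set L" if "(n, R, ps) \<in> X" "p \<in> set ps" for n R ps p
    using that L by blast
  \<comment> \<open>Every point in \<open>L\<close> has a quantified variable, with index offset by
    \<open>?m\<close>. The free variables are tied by equations to those of \<open>qs\<close>, which
    may contain repetitions.\<close>
  define eqs where "eqs = map (\<lambda>i. PEq i (?m + idx (qs ! i)) :: 'a pp_atom) [0..<?m]"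
  define rels where "rels = map (\<lambda>(n, R, ps). PRel (n, R) (map (\<lambda>p. ?m + idx p) ps)) Xs"
  have "pp_atom_wf \<Gamma> (?m + length L) a" if "a \<in> set eqs" for a
  proof -
    obtain i where "i < ?m" "a = PEq i (?m + idx (qs ! i))" using \<open>a \<in> set eqs\<close> by (auto simp: eqs_def)
    then show ?thesis using idx(1)[OF qsL] by simp
  qed
  moreover have "pp_atom_wf \<Gamma> (?m + length L) a" if "a \<in> set rels" for a
  proof -
    obtain n R ps where x: "(n, R, ps) \<in> X" and a: "a = PRel (n, R) (map (\<lambda>p. ?m + idx p) ps)"
      using \<open>a \<in> set rels\<close> by (auto simp: rels_def Xs)
    then show ?thesis using assms(2)[OF x] idx(1)[OF psL[OF x]] by simp
  qed
  ultimately have wf: "\<forall>a\<in>set (eqs @ rels). pp_atom_wf \<Gamma> (?m + length L) a"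
    by (auto simp del: pp_atom_wf.simps)
  define P where "P g \<longleftrightarrow> (\<forall>(n, R, ps)\<in>X. map g ps \<in> R)" for g
  have P_cong: "P g \<longleftrightarrow> P g'" if "\<And>p. p \<in> set L \<Longrightarrow> g p = g' p" for g g'
  proof -
    have "map g ps = map g' ps" if "(n, R, ps) \<in> X" for n R ps
      using psL[OF that] \<open>\<And>p. p \<in> set L \<Longrightarrow> g p = g' p\<close> by simp
    then show ?thesis unfolding P_def by (metis (no_types, lifting) case_prodD case_prodI2)
  qed
  define H where "H xs ys \<longleftrightarrow> (\<forall>a\<in>set (eqs @ rels). pp_atom_holds a (xs @ ys))" for xs ys
  have H: "H xs ys \<longleftrightarrow> xs = map (\<lambda>p. ys ! idx p) qs \<and> P (\<lambda>p. ys ! idx p)"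
    if len: "length xs = ?m" for xs ys
  proof -
    have "(\<forall>a\<in>set eqs. pp_atom_holds a (xs @ ys)) \<longleftrightarrow> (\<forall>i<?m. xs ! i = ys ! idx (qs ! i))"
      using len by (auto simp: eqs_def nth_append)
    also have "\<dots> \<longleftrightarrow> xs = map (\<lambda>p. ys ! idx p) qs"
      unfolding list_eq_iff_nth_eq using len by simp
    finally have "(\<forall>a\<in>set eqs. pp_atom_holds a (xs @ ys)) \<longleftrightarrow> xs = map (\<lambda>p. ys ! idx p) qs" .
    moreover have "pp_atom_holds (PRel (n, R) (map (\<lambda>p. ?m + idx p) ps)) (xs @ ys) \<longleftrightarrow>
        map (\<lambda>p. ys ! idx p) ps \<in> R" for n R ps
      using len by (simp add: comp_def nth_append)
    then have "(\<forall>a\<in>set rels. pp_atom_holds a (xs @ ys)) \<longleftrightarrow> P (\<lambda>p. ys ! idx p)"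
      unfolding P_def rels_def set_map Xs ball_simps(9)
      by (simp only: split_beta case_prod_unfold)
    ultimately show ?thesis unfolding H_def set_append ball_Un by simp
  qed
  have "{map g qs | g. P g} = {xs. length xs = ?m \<and> (\<exists>ys. length ys = length L \<and> H xs ys)}"
    (is "?A = ?B")
  proof (intro set_eqI iffI)
    fix xs assume "xs \<in> ?A"
    then obtain g where g: "xs = map g qs" "P g" by blast
    have ys: "map g L ! idx p = g p" if "p \<in> set L" for p using idx[OF that] by simp
    then have "P (\<lambda>p. map g L ! idx p)" using P_cong[of "\<lambda>p. map g L ! idx p" g] g(2) by simp
    moreover have "xs = map (\<lambda>p. map g L ! idx p) qs" using g(1) ys[OF qsL] by simp
    ultimately have "H xs (map g L)" using H[of xs] g(1) by simp
    then show "xs \<in> ?B" using g(1) by (intro CollectI conjI exI[of _ "map g L"]) simp_all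
  next
    fix xs assume "xs \<in> ?B"
    then obtain ys where "length xs = ?m" "H xs ys" by blast
    then show "xs \<in> ?A" using H by blast
  qed
  then have "{map g qs | g. \<forall>(n, R, ps)\<in>X. map g ps \<in> R} = {xs. length xs = ?m \<and>
      (\<exists>ys. length ys = length L \<and> (\<forall>a\<in>set (eqs @ rels). pp_atom_holds a (xs @ ys)))}"
    by (simp only: P_def H_def)
  then show ?thesis using wf unfolding pp_definable_def by blast
qed

section \<open>The binary polymorphisms of a reduct\<close>

locale reduct = random_order le for le :: "'a \<Rightarrow> 'a \<Rightarrow> bool" +
  fixes \<Gamma> :: "'a rstruct"
  assumes is_reduct: "is_reduct le \<Gamma>"
    and pp_inc: "pp_definable \<Gamma> 2 (IncompRel le)"
    and pp_lt: "pp_definable \<Gamma> 2 (LtRel le)"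
begin

lemma length_rel: "(n, R) \<in> \<Gamma> \<Longrightarrow> t \<in> R \<Longrightarrow> length t = n"
  using is_reduct unfolding is_reduct_def by blast

lemma rel_aut: "(n, R) \<in> \<Gamma> \<Longrightarrow> order_aut le \<alpha> \<Longrightarrow> t \<in> R \<Longrightarrow> map \<alpha> t \<in> R"
  using is_reduct fo_definable_aut unfolding is_reduct_def by blast

lemma Pol2_proj:
  assumes "order_aut le \<alpha>"
  shows "(\<lambda>p. \<alpha> (fst p)) \<in> Pol2 \<Gamma>" "(\<lambda>p. \<alpha> (snd p)) \<in> Pol2 \<Gamma>"
proof -
  have "map (\<lambda>p. \<alpha> (fst p)) (zip s t) \<in> R \<and> map (\<lambda>p. \<alpha> (snd p)) (zip s t) \<in> R"
    if st: "(n, R) \<in> \<Gamma>" "s \<in> R" "t \<in> R" for n R s t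
  proof -
    have "length s = length t" using length_rel[OF st(1)] st(2,3) by simp
    then have "map (\<lambda>p. \<alpha> (fst p)) (zip s t) = map \<alpha> s" "map (\<lambda>p. \<alpha> (snd p)) (zip s t) = map \<alpha> t"
      by (simp_all add: list_eq_iff_nth_eq)
    then show ?thesis using rel_aut[OF st(1) assms] st(2,3) by simp
  qed
  then show "(\<lambda>p. \<alpha> (fst p)) \<in> Pol2 \<Gamma>" "(\<lambda>p. \<alpha> (snd p)) \<in> Pol2 \<Gamma>"
    by (simp_all add: Pol2I)
qed

lemma Pol2_comp:
  assumes huv: "h \<in> Pol2 \<Gamma>" "u \<in> Pol2 \<Gamma>" "v \<in> Pol2 \<Gamma>"
  shows "(\<lambda>p. h (u p, v p)) \<in> Pol2 \<Gamma>"
proof -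
  have "map (\<lambda>p. h (u p, v p)) (zip s t) \<in> R" if "(n, R) \<in> \<Gamma>" "s \<in> R" "t \<in> R" for n R s t
  proof -
    have "map h (zip (map u (zip s t)) (map v (zip s t))) \<in> R"
      using Pol2D[OF huv(1) that(1) Pol2D[OF huv(2) that] Pol2D[OF huv(3) that]] .
    moreover have "map h (zip (map u zs) (map v zs)) = map (\<lambda>p. h (u p, v p)) zs" for zs
      by (induction zs) simp_all
    ultimately show ?thesis by simp
  qed
  then show ?thesis by (rule Pol2I)
qed

lemma Pol2_lt:
  assumes "h \<in> Pol2 \<Gamma>" "lt (fst p) (fst q)" "lt (snd p) (snd q)"
  shows "lt (h p) (h q)"
proof -
  have "map h (zip [fst p, fst q] [snd p, snd q]) \<in> LtRel le"
    by (rule Pol2_preserves_pp[OF assms(1) pp_lt]) (use assms in \<open>simp_all add: LtRel_def\<close>)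
  then show ?thesis by (simp add: LtRel_def)
qed

lemma Pol2_inc:
  assumes "h \<in> Pol2 \<Gamma>" "inc (fst p) (fst q)" "inc (snd p) (snd q)"
  shows "inc (h p) (h q)"
proof -
  have "map h (zip [fst p, fst q] [snd p, snd q]) \<in> IncompRel le"
    by (rule Pol2_preserves_pp[OF assms(1) pp_inc]) (use assms in \<open>simp_all add: IncompRel_def\<close>)
  then show ?thesis by (simp add: IncompRel_def)
qed

sublocale order_clone le "Pol2 \<Gamma>"
  by unfold_locales (fact Pol2_proj Pol2_comp Pol2_lt Pol2_inc)+

lemma Low_aut:
  assumes "order_aut le \<alpha>"
  shows "[\<alpha> x, \<alpha> y, \<alpha> z] \<in> Low le \<longleftrightarrow> [x, y, z] \<in> Low le"
proof -
  have "lt (\<alpha> u) (\<alpha> v) \<longleftrightarrow> lt u v" "inc (\<alpha> u) (\<alpha> v) \<longleftrightarrow> inc u v" for u v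
    using assms by (simp_all add: order_aut_def bij_def inj_eq lt_of_def incomp_def)
  then show ?thesis by (simp add: Low_iff)
qed

lemma ex_lt_inc: obtains a b c where "lt a b" "inc c a" "inc c b"
proof -
  obtain x where "\<And>i j. i < 3 \<Longrightarrow> j < 3 \<Longrightarrow> lt (x i) (x j) \<longleftrightarrow> (i, j) \<in> {(0 :: nat, 1 :: nat)}"
    "\<And>i j. i < 3 \<Longrightarrow> j < 3 \<Longrightarrow>
       inc (x i) (x j) \<longleftrightarrow> i \<noteq> j \<and> (i, j) \<notin> {(0, 1)} \<and> (j, i) \<notin> {(0, 1)}"
    using realize_strict_order[of "{(0, 1)}" 3] by (auto simp: trans_def irrefl_def)
  then show thesis using that[of "x 0" "x 1" "x 2"] by simp
qed

text \<open>The rows \<open>a, b, c\<close> and \<open>a, c, b\<close> represent the two orbits of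
  triples in \<open>Low\<close>. Without such an \<open>f\<close>, compactness would give finitely
  many polymorphism conditions that force the image of these rows into \<open>Low\<close>, and these
  conditions would form a primitive positive definition of \<open>Low\<close>.\<close>

lemma Low_violating_polymorphism:
  assumes "\<not> pp_definable \<Gamma> 3 (Low le)" and abc: "lt a b" "inc c a" "inc c b"
  obtains f where "f \<in> Pol2 \<Gamma>" "[f (a, a), f (b, c), f (c, b)] \<notin> Low le"
proof -
  \<comment> \<open>Satisfying all \<open>kf x\<close> with \<open>x\<close> in \<open>X\<close>
    means being a binary polymorphism; \<open>kl\<close> adds the violation.\<close>
  define X where "X = {(n, R, zip s t) | n R s t. (n, R) \<in> \<Gamma> \<and> s \<in> R \<and> t \<in> R}"
  define kf :: "nat \<times> 'a list set \<times> ('a \<times> 'a) list \<Rightarrow> ('a \<times> 'a \<Rightarrow> 'a) \<Rightarrow> bool"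
    where "kf x g \<longleftrightarrow> (case x of (n, R, ps) \<Rightarrow> map g ps \<in> R)" for x g
  define kl :: "('a \<times> 'a \<Rightarrow> 'a) \<Rightarrow> bool"
    where "kl g \<longleftrightarrow> [g (a, a), g (b, c), g (c, b)] \<notin> Low le" for g
  have "\<exists>g. \<forall>k\<in>insert kl (kf ` X). k g"
  proof (rule compactness)
    show "countable (UNIV :: ('a \<times> 'a) set)"
      using countable_SIGMA[OF countable_UNIV countable_UNIV] by simp
  next
    fix k g \<alpha> assume k: "k \<in> insert kl (kf ` X)" and \<alpha>: "order_aut le \<alpha>" and "k g"
    show "k (\<lambda>i. \<alpha> (g i))"
    proof (cases "k = kl")
      case True
      then show ?thesis using \<open>k g\<close> Low_aut[OF \<alpha>] by (simp add: kl_def)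
    next
      case False
      then obtain n R ps where "(n, R) \<in> \<Gamma>" "k = kf (n, R, ps)" using k by (auto simp: X_def)
      then show ?thesis using \<open>k g\<close> rel_aut[OF _ \<alpha>, of n R "map g ps"]
        by (simp add: kf_def comp_def)
    qed
  next
    fix k assume k: "k \<in> insert kl (kf ` X)"
    show "\<exists>F. finite F \<and> (\<forall>g g'. (\<forall>i\<in>F. g i = g' i) \<longrightarrow> k g \<longrightarrow> k g')"
    proof (cases "k = kl")
      case True
      then show ?thesis by (intro exI[of _ "{(a, a), (b, c), (c, b)}"]) (simp add: kl_def)
    next
      case False
      then obtain n R ps where k: "k = kf (n, R, ps)" using k by auto
      have "k g'" if "\<forall>i\<in>set ps. g i = g' i" "k g" for g g'
      proof -
        have "map g ps = map g' ps" using that(1) by simp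
        moreover have "map g ps \<in> R" using that(2) by (simp add: k kf_def)
        ultimately show ?thesis by (simp add: k kf_def del: map_eq_conv)
      qed
      then show ?thesis by (intro exI[of _ "set ps"]) blast
    qed
  next
    fix \<Theta> assume \<Theta>: "finite \<Theta>" "\<Theta> \<subseteq> insert kl (kf ` X)"
    then have "finite (\<Theta> - {kl})" "\<Theta> - {kl} \<subseteq> kf ` X" by auto
    then obtain Y where Y: "Y \<subseteq> X" "finite Y" "\<Theta> - {kl} = kf ` Y"
      by (metis finite_subset_image)
    have "\<exists>g. kl g \<and> (\<forall>x\<in>Y. kf x g)"
    proof (rule ccontr)
      assume "\<not> ?thesis"
      then have no: "[g (a, a), g (b, c), g (c, b)] \<in> Low le" if "\<forall>x\<in>Y. kf x g" for g
        using that unfolding kl_def by blast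
      let ?qs = "[(a, a), (b, c), (c, b)]"
      let ?S = "{map g ?qs | g. \<forall>(n, R, ps)\<in>Y. map g ps \<in> R}"
      have proj: "\<forall>(n, R, ps)\<in>Y. map g ps \<in> R" if "g \<in> Pol2 \<Gamma>" for g
      proof -
        have "map g ps \<in> R" if x: "(n, R, ps) \<in> Y" for n R ps
        proof -
          obtain s t where "ps = zip s t" "(n, R) \<in> \<Gamma>" "s \<in> R" "t \<in> R"
            using x Y(1) unfolding X_def by blast
          then show ?thesis using Pol2D[OF \<open>g \<in> Pol2 \<Gamma>\<close>] by blast
        qed
        then show ?thesis by blast
      qed
      \<comment> \<open>A triple in \<open>Low\<close> is the image of one of the two rows under an
        automorphism \<open>\<alpha>\<close>. Composed with the matching projection,
        \<open>\<alpha>\<close> is a polymorphism and so meets the constraints in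
        \<open>Y\<close>.\<close>
      have "xs \<in> ?S" if xs: "xs \<in> Low le" for xs
      proof -
        obtain x y z where xyz: "xs = [x, y, z]" using xs by (auto simp: Low_def)
        from xs consider "lt x y" "inc z x" "inc z y" | "lt x z" "inc y x" "inc y z"
          unfolding xyz Low_iff by blast
        then show ?thesis
        proof cases
          case 1
          from lt_inc_aut[OF abc 1] obtain \<alpha> where
            \<alpha>: "order_aut le \<alpha>" "\<alpha> a = x" "\<alpha> b = y" "\<alpha> c = z" .
          have "xs = map (\<lambda>p. \<alpha> (fst p)) ?qs" by (simp add: xyz \<alpha>)
          then show ?thesis using proj[OF proj1[OF \<alpha>(1)]] by blast
        next
          case 2
          from lt_inc_aut[OF abc 2] obtain \<alpha> where
            \<alpha>: "order_aut le \<alpha>" "\<alpha> a = x" "\<alpha> b = z" "\<alpha> c = y" .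
          have "xs = map (\<lambda>p. \<alpha> (snd p)) ?qs" by (simp add: xyz \<alpha>)
          then show ?thesis using proj[OF proj2[OF \<alpha>(1)]] by blast
        qed
      qed
      moreover have "xs \<in> Low le" if "xs \<in> ?S" for xs
      proof -
        obtain g where "xs = map g ?qs" "\<forall>(n, R, ps)\<in>Y. map g ps \<in> R" using \<open>xs \<in> ?S\<close> by blast
        then show ?thesis using no[of g] by (simp add: kf_def)
      qed
      ultimately have "Low le = ?S" by blast
      moreover have "(n, R) \<in> \<Gamma> \<and> length ps = n" if "(n, R, ps) \<in> Y" for n R ps
        using that Y(1) length_rel unfolding X_def by force
      ultimately have "pp_definable \<Gamma> (length ?qs) (Low le)"
        using pp_definable_finite_instance[OF Y(2), of \<Gamma> ?qs] by simp
      then show False using assms(1) by (simp add: numeral_3_eq_3)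
    qed
    then obtain g where g: "kl g" "\<forall>k\<in>\<Theta> - {kl}. k g" unfolding Y(3) by blast
    have "k g" if "k \<in> \<Theta>" for k using g that by (cases "k = kl") auto
    then show "\<exists>g. \<forall>k\<in>\<Theta>. k g" by blast
  qed
  then obtain g where g: "kl g" "\<forall>x\<in>X. kf x g" by blast
  have "map g (zip s t) \<in> R" if "(n, R) \<in> \<Gamma>" "s \<in> R" "t \<in> R" for n R s t
  proof -
    have "(n, R, zip s t) \<in> X" using that unfolding X_def by blast
    then have "kf (n, R, zip s t) g" using g(2) by blast
    then show ?thesis by (simp add: kf_def)
  qed
  then have "g \<in> Pol2 \<Gamma>" by (rule Pol2I)
  then show thesis using that g(1) unfolding kl_def by blast
qed

text \<open>On the columns of two given tuples \<open>h\<close> and \<open>e\<close> induce the same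
  order, so by homogeneity an automorphism turns the values of \<open>h\<close> into those of
  \<open>e\<close>. The relations of \<open>\<Gamma>\<close> are invariant under it.\<close>

lemma Pol2_of_local:
  assumes local: "\<And>A. finite A \<Longrightarrow> \<exists>h\<in>Pol2 \<Gamma>. \<forall>p\<in>A. \<forall>q\<in>A. le (h p) (h q) \<longleftrightarrow> le (e p) (e q)"
  shows "e \<in> Pol2 \<Gamma>"
proof -
  have "map e (zip s t) \<in> R" if st: "(n, R) \<in> \<Gamma>" "s \<in> R" "t \<in> R" for n R s t
  proof -
    let ?A = "set (zip s t)"
    obtain h where h: "h \<in> Pol2 \<Gamma>" "\<forall>p\<in>?A. \<forall>q\<in>?A. le (h p) (h q) \<longleftrightarrow> le (e p) (e q)"
      using local[of ?A] by blast
    have "le x y \<longleftrightarrow> le x' y'"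
      if "(x, x') \<in> (\<lambda>p. (h p, e p)) ` ?A" "(y, y') \<in> (\<lambda>p. (h p, e p)) ` ?A" for x x' y y'
      using that h(2) by blast
    then obtain \<alpha> where \<alpha>: "order_aut le \<alpha>"
        "\<And>x x'. (x, x') \<in> (\<lambda>p. (h p, e p)) ` ?A \<Longrightarrow> \<alpha> x = x'"
      using finite_iso_extends[of "(\<lambda>p. (h p, e p)) ` ?A"] by blast
    have "map h (zip s t) \<in> R" by (rule Pol2D[OF h(1) st])
    then have "map \<alpha> (map h (zip s t)) \<in> R" using rel_aut st(1) \<alpha>(1) by blast
    moreover have "\<alpha> (h p) = e p" if "p \<in> ?A" for p using \<alpha>(2) that by blast
    then have "map \<alpha> (map h (zip s t)) = map e (zip s t)" by simp
    ultimately show ?thesis by (simp only:)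
  qed
  then show ?thesis by (rule Pol2I)
qed

end

theorem theorem46:
  fixes le :: "'a \<Rightarrow> 'a \<Rightarrow> bool"
    and \<Gamma> :: "'a rstruct"
    and e_lt e_le :: "'a \<Rightarrow> 'a \<Rightarrow> 'a"
  assumes "random_poset le"
    and "emb_lt le e_lt"
    and "emb_le le e_le"
    and "is_reduct le \<Gamma>"
    and "pp_definable \<Gamma> 2 (IncompRel le)"
    and "pp_definable \<Gamma> 2 (LtRel le)"
  shows "\<not> pp_definable \<Gamma> 3 (Low le) \<longleftrightarrow>
           (binop e_lt \<in> Pol \<Gamma> \<or> binop e_le \<in> Pol \<Gamma>)"
proof -
  interpret reduct le \<Gamma>
    using assms(1,4-6) by unfold_locales
  define f_lt where "f_lt p = e_lt (fst p) (snd p)" for p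
  define f_le where "f_le p = e_le (fst p) (snd p)" for p
  have Pol_lt: "binop e_lt \<in> Pol \<Gamma> \<longleftrightarrow> f_lt \<in> Pol2 \<Gamma>"
    unfolding f_lt_def by (rule binop_in_Pol_iff) (fact length_rel)
  have Pol_le: "binop e_le \<in> Pol \<Gamma> \<longleftrightarrow> f_le \<in> Pol2 \<Gamma>"
    unfolding f_le_def by (rule binop_in_Pol_iff) (fact length_rel)
  have f_lt: "lt (f_lt p) (f_lt q) \<longleftrightarrow> lt (fst p) (fst q) \<and> lt (snd p) (snd q)" for p q
    using assms(2) unfolding emb_lt_def f_lt_def by blast
  have "(\<lambda>(a, b). e_lt a b) = f_lt" by (simp add: f_lt_def fun_eq_iff)
  then have "inj f_lt" using assms(2) unfolding emb_lt_def by simp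
  then have f_lt_eq: "f_lt p = f_lt q \<longleftrightarrow> p = q" for p q by (rule inj_eq)
  \<comment> \<open>Injectivity settles the case of equal images; strict comparabilities come from
    \<open>emb_lt\<close>.\<close>
  have f_lt_le: "le (f_lt p) (f_lt q) \<longleftrightarrow> p = q \<or> lt (fst p) (fst q) \<and> lt (snd p) (snd q)" for p q
    using f_lt[of p q] f_lt_eq[of p q] by (auto simp: lt_of_def)
  have f_le: "le (f_le p) (f_le q) \<longleftrightarrow> le (fst p) (fst q) \<and> le (snd p) (snd q)" for p q
    using assms(3) unfolding emb_le_def f_le_def by blast
  obtain a b c where abc: "lt a b" "inc c a" "inc c b" using ex_lt_inc .
  show ?thesis
  proof
    assume "\<not> pp_definable \<Gamma> 3 (Low le)"
    from Low_violating_polymorphism[OF this abc] obtain f where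
      f: "f \<in> Pol2 \<Gamma>" "[f (a, a), f (b, c), f (c, b)] \<notin> Low le" .
    interpret low_violating_clone le "Pol2 \<Gamma>" f a b c a c b
      using f abc by unfold_locales
    from local_embedding show "binop e_lt \<in> Pol \<Gamma> \<or> binop e_le \<in> Pol \<Gamma>"
    proof
      assume "\<forall>A. finite A \<longrightarrow> (\<exists>h\<in>Pol2 \<Gamma>. \<forall>p\<in>A. \<forall>q\<in>A. le (h p) (h q) \<longleftrightarrow>
        p = q \<or> lt (fst p) (fst q) \<and> lt (snd p) (snd q))"
      then have "f_lt \<in> Pol2 \<Gamma>" unfolding f_lt_le[symmetric] by (intro Pol2_of_local) blast
      then show ?thesis by (simp add: Pol_lt)
    next
      assume "\<forall>A. finite A \<longrightarrow> (\<exists>h\<in>Pol2 \<Gamma>. \<forall>p\<in>A. \<forall>q\<in>A. le (h p) (h q) \<longleftrightarrow>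
        le (fst p) (fst q) \<and> le (snd p) (snd q))"
      then have "f_le \<in> Pol2 \<Gamma>" unfolding f_le[symmetric] by (intro Pol2_of_local) blast
      then show ?thesis by (simp add: Pol_le)
    qed
  next
    assume "binop e_lt \<in> Pol \<Gamma> \<or> binop e_le \<in> Pol \<Gamma>"
    \<comment> \<open>Both embeddings reflect the product order. As \<open>(a, a)\<close> is below
      neither \<open>(b, c)\<close> nor \<open>(c, b)\<close>, its image is below neither of theirs,
      whereas \<open>Low\<close> requires its first entry to be below one of the others.\<close>
    then obtain f where f: "f \<in> Pol2 \<Gamma>"
      "\<And>p q. le (f p) (f q) \<Longrightarrow> le (fst p) (fst q) \<and> le (snd p) (snd q)"
      using Pol_lt Pol_le f_lt_le f_le lt_imp_le le_refl by metis
    show "\<not> pp_definable \<Gamma> 3 (Low le)"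
    proof
      assume pp: "pp_definable \<Gamma> 3 (Low le)"
      have "map f (zip [a, b, c] [a, c, b]) \<in> Low le"
        by (rule Pol2_preserves_pp[OF f(1) pp]) (use abc inc_sym in \<open>simp_all add: Low_iff\<close>)
      then have "lt (f (a, a)) (f (b, c)) \<or> lt (f (a, a)) (f (c, b))"
        by (simp add: Low_iff) blast
      then have "le (f (a, a)) (f (b, c)) \<or> le (f (a, a)) (f (c, b))" using lt_imp_le by blast
      then have "le a c" using f(2)[of "(a, a)" "(b, c)"] f(2)[of "(a, a)" "(c, b)"] by auto
      then show False using abc(2) by (simp add: incomp_def)
    qed
  qed
qed

end
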